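(* Let $d\ge 2$, let $F\colon\mathbb{R}^d\to\mathbb{R}^d$ be a Zorich map (as defined in the context), and for $a\in\mathbb{R}$ let $f_a(x)=F(x)-(0,\dots,0,a)$. Then there exists $a_0$ such that for all $a\ge a_0$ $$d-1+\frac12\,\frac{\log\log a}{\log a}-\frac{\log\log\log a}{\log a}<\dim J_{\mathrm{bd}}(f_a)\le \dim J_{\mathrm{r}}(f_a)\le d-1+\frac{\log\log a}{\log a}.$$
   Context: $\dim$ denotes Hausdorff dimension and $|x|$ the Euclidean norm. Zorich map. Let $d\ge2$, fix $\rho>0$, let $Q=[-\rho,\rho]^{d-1}\subset\mathbb{R}^{d-1}$ and let $U=\{x\in\mathbb{R}^d: |x|=1,\ x_d\ge 0\}$ be the closed upper hemisphere. Let $h\colon Q\to U$ be a surjective bi-Lipschitz map. Define $F\colon Q\times\mathbb{R}\to\mathbb{R}^d$ by $F(x_1,\dots,x_d)=e^{x_d}h(x_1,\dots,x_{d-1})$, and extend $F$ to $\mathbb{R}^d$ by repeated reflection at hyperplanes: reflecting $x$ in a hyperplane $\{x_j=(2k+1)\rho\}$ ($1\le j\le d-1$, $k\in\mathbb{Z}$) corresponds to reflecting $F(x)$ in $\{x_d=0\}$. Explicitly, for $r\in\mathbb{Z}^{d-1}$ and $x\in\mathbb{R}^d$ with $|x_j-2\rho r_j|\le\rho$ for $1\le j\le d-1$, $$F(x)=\sigma^{r_1+\dots+r_{d-1}}\Big(e^{x_d}h\big((-1)^{r_1}(x_1-2\rho r_1),\dots,(-1)^{r_{d-1}}(x_{d-1}-2\rho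 r_{d-1})\big)\Big),$$ where $\sigma(y_1,\dots,y_d)=(y_1,\dots,y_{d-1},-y_d)$. Attracting fixed point. There are constants $0<\alpha<1$ and $m<M$ with $M\ge0$, fixed once and for all, such that $\sup_{|v|=1}|DF(x)v|\le\alpha$ for a.e. $x$ with $x_d\le m$, and $\inf_{|v|=1}|DF(x)v|\ge 1/\alpha$ for a.e. $x$ with $x_d\ge M$. If $a\ge e^M-m$ (in particular if $a$ is sufficiently large), then $f_a$ maps $\{x: x_d\le m\}$ into itself and is a contraction there, and $\xi_a$ denotes its attracting fixed point in $\{x:x_d\le m\}$ (unique in this half-space). Sets. With $f_a^n$ the $n$-th iterate, $$J_{\mathrm{bd}}(f_a)=\{x\in\mathbb{R}^d: f_a^n(x)\not\to\xi_a\text{ and }(f_a^n(x))_{n}\text{ is bounded}\},$$ $$J_{\mathrm{r}}(f_a)=\{x\in\mathbb{R}^d: f_a^n(x)\not\to\xi_a\text{ and }|f_a^n(x)|\not\to\infty\}.$$ *)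

theory Defs
  imports "HOL-Analysis.Analysis"
begin

section \<open>Hausdorff measure and Hausdorff dimension\<close>

text \<open>
  The \<open>s\<close>-th power of the diameter, with the convention that the zeroth power is
  \<open>1\<close> for nonempty sets (note \<open>0 powr 0 = 0\<close>).
  It is only ever applied to bounded sets, since \<^const>\<open>diameter\<close> is meaningless otherwise.
\<close>
definition diam_power :: "real \<Rightarrow> 'a::metric_space set \<Rightarrow> ennreal" where
  "diam_power s U =
     (if U = {} then 0 else if s = 0 then 1 else ennreal (diameter U powr s))"

definition hausdorff_content :: "real \<Rightarrow> real \<Rightarrow> 'a::metric_space set \<Rightarrow> ennreal" where
  "hausdorff_content \<delta> s A =
     (INF U \<in> {U :: nat \<Rightarrow> 'a set. A \<subseteq> (\<Union>i. U i) \<and> (\<forall>i. bounded (U i) \<and> diameter (U i) \<le> \<delta>)}.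
        (\<Sum>i. diam_power s (U i)))"

definition hausdorff_measure :: "real \<Rightarrow> 'a::metric_space set \<Rightarrow> ennreal" where
  "hausdorff_measure s A = (SUP \<delta> \<in> {0<..}. hausdorff_content \<delta> s A)"

definition hausdorff_dim :: "'a::metric_space set \<Rightarrow> ereal" where
  "hausdorff_dim A = (INF s \<in> {s. 0 \<le> s \<and> hausdorff_measure s A = 0}. ereal s)"


section \<open>Zorich maps\<close>

text \<open>
  We model $\mathbb{R}^d$, $d \geq 2$, as $\mathbb{R}^{d-1} \times \mathbb{R}$ with
  $d - 1 = \mathrm{card}$ of the (nonempty, finite) index type; the norm of the product type is the
  Euclidean one, and \<^const>\<open>snd\<close> is the last coordinate $x_d$.
\<close>
type_synonym 'n space = "(real ^ 'n) \<times> real"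

definition cube :: "real \<Rightarrow> (real ^ 'n::finite) set" where
  "cube \<rho> = {x. \<forall>j. \<bar>x $ j\<bar> \<le> \<rho>}"

definition upper_hemisphere :: "('n::finite) space set" where
  "upper_hemisphere = {x. norm x = 1 \<and> snd x \<ge> 0}"

definition bi_lipschitz_on :: "'a::metric_space set \<Rightarrow> ('a \<Rightarrow> 'b::metric_space) \<Rightarrow> bool" where
  "bi_lipschitz_on S h \<longleftrightarrow>
     (\<exists>L>0. \<forall>x\<in>S. \<forall>y\<in>S. dist x y / L \<le> dist (h x) (h y) \<and> dist (h x) (h y) \<le> L * dist x y)"

text \<open>The \<open>k\<close>-th power of the reflection in the hyperplane $\{x_d = 0\}$.\<close>
definition reflect_pow :: "int \<Rightarrow> ('n::finite) space \<Rightarrow> 'n space" where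
  "reflect_pow k y = (fst y, (-1) powi k * snd y)"

text \<open>
  If \<open>x\<close> lies over a common face of several cubes, the formula is required for each of the
  corresponding \<open>r\<close>. These requirements are compatible: by invariance of domain, \<open>h\<close>
  maps the boundary of the cube onto the equator $\{|x| = 1, x_d = 0\}$. Hence \<open>\<rho>\<close>
  and \<open>h\<close> determine exactly one such \<open>F\<close>.
\<close>
definition zorich_map ::
    "real \<Rightarrow> (real ^ 'n::finite \<Rightarrow> 'n space) \<Rightarrow> ('n space \<Rightarrow> 'n space) \<Rightarrow> bool" where
  "zorich_map \<rho> h F \<longleftrightarrow>
     \<rho> > 0 \<and> bi_lipschitz_on (cube \<rho>) h \<and> h ` cube \<rho> = upper_hemisphere \<and>
     (\<forall>(r :: 'n \<Rightarrow> int) x.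
        (\<forall>j. \<bar>fst x $ j - 2 * \<rho> * of_int (r j)\<bar> \<le> \<rho>) \<longrightarrow>
        F x = reflect_pow (\<Sum>j\<in>UNIV. r j)
                (exp (snd x) *\<^sub>R
                   h (\<chi> j. (-1) powi (r j) * (fst x $ j - 2 * \<rho> * of_int (r j)))))"

text \<open>
  Zorich maps are locally Lipschitz, hence differentiable almost everywhere by Rademacher's
  theorem, so that requiring the existence of the derivative is no restriction.
\<close>
definition zorich_constants ::
    "(('n::finite) space \<Rightarrow> 'n space) \<Rightarrow> real \<Rightarrow> real \<Rightarrow> real \<Rightarrow> bool" where
  "zorich_constants F \<alpha> m M \<longleftrightarrow>
     0 < \<alpha> \<and> \<alpha> < 1 \<and> m < M \<and> 0 \<le> M \<and>
     (AE x in lebesgue. snd x \<le> m \<longrightarrow>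
        (\<exists>D. (F has_derivative D) (at x) \<and> (SUP v \<in> sphere 0 1. norm (D v)) \<le> \<alpha>)) \<and>
     (AE x in lebesgue. snd x \<ge> M \<longrightarrow>
        (\<exists>D. (F has_derivative D) (at x) \<and> (INF v \<in> sphere 0 1. norm (D v)) \<ge> 1 / \<alpha>))"

definition shifted :: "(('n::finite) space \<Rightarrow> 'n space) \<Rightarrow> real \<Rightarrow> 'n space \<Rightarrow> 'n space" where
  "shifted F a x = F x - (0, a)"

text \<open>Well defined for \<open>f = shifted F a\<close> with $a \geq e^M - m$.\<close>
definition attracting_fixpoint :: "(('n::finite) space \<Rightarrow> 'n space) \<Rightarrow> real \<Rightarrow> 'n space" where
  "attracting_fixpoint f m = (THE \<xi>. snd \<xi> \<le> m \<and> f \<xi> = \<xi>)"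

definition J_bd :: "('a::real_normed_vector \<Rightarrow> 'a) \<Rightarrow> 'a \<Rightarrow> 'a set" where
  "J_bd f \<xi> = {x. \<not> (\<lambda>n. (f ^^ n) x) \<longlonglongrightarrow> \<xi> \<and> bounded (range (\<lambda>n. (f ^^ n) x))}"

definition J_r :: "('a::real_normed_vector \<Rightarrow> 'a) \<Rightarrow> 'a \<Rightarrow> 'a set" where
  "J_r f \<xi> = {x. \<not> (\<lambda>n. (f ^^ n) x) \<longlonglongrightarrow> \<xi> \<and>
                \<not> filterlim (\<lambda>n. norm ((f ^^ n) x)) at_top sequentially}"

end

theory Submission
  imports Defs "HOL-Probability.Infinite_Product_Measure" "HOL-Real_Asymp.Real_Asymp"
begin

text \<open>
  Write $N = d - 1$. Over a single cell (a translate of the cube times $\mathbb{R}$) the map is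
  $F(x', t) = e^t h(x')$ up to reflections, that is, polar coordinates with a bi-Lipschitz
  parametrisation of the angle. Hence $|F(x)| = e^t$, and on each cell $F$ stretches all distances by
  $e^t$ up to a factor \<open>L\<close> (\<open>zorich.dist_F_cell\<close>). If $f_a(x)$ lies in the cell with index
  $q \in \mathbb{Z}^N$ and $|f_a(x)|$ is not dominated by its last coordinate, then
  $e^t = |f_a(x) + (0, a)|$ is comparable to $\max(a, |q|)$. So the inverse branches of $f_a$ behave
  like an infinite iterated function system with one letter for each cell, where the letter \<open>q\<close>
  contracts by about $1/\max(a, |q|)$, and the dimension $s = N + \epsilon$ is governed by the sum
  \[ \sum_{q \in \mathbb{Z}^N} \max(a, |q|)^{-s} \approx \frac{a^{-\epsilon}}{\epsilon} . \]
  All distortion constants enter as one factor per letter, so it suffices to decide whether this sum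
  tends to zero or to infinity as $a \to \infty$.

  Upper bound. For large \<open>a\<close> the half-space $\{t \le m\}$ lies in the basin of
  $\xi_a$ (\<open>zorich.halfspace_in_basin\<close>), so a point of $J_r$ has its whole orbit in
  $\{t > m\}$, and it returns infinitely often to some ball. The points that return to a given ball at
  time \<open>n\<close> are covered, by pulling the ball back \<open>n\<close> times, at a cost that decays
  geometrically once the sum above, with constants, is less than 1
  (\<open>zorich.covered_returning\<close>). With $\epsilon = \log\log a / \log a$ one has
  $a^{-\epsilon} = 1/\log a$, and the sum is of order $1/\log\log a$.

  Lower bound. Only cells with even indices are used; these are pairwise at distance at least
  $2\rho$. Finitely many of them, cut off at $0 \le t \le a$, are each mapped over all the others, so
  every sequence of letters is realised by a point with bounded orbit. A Bernoulli measure on the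
  sequences then bounds the dimension from below by \<open>s\<close> as soon as the sum of the
  \<open>s\<close>-th powers of the contractions is at least 1 (\<open>hausdorff_dim_ge_coded\<close>). Two points
  closer than the separation share a letter, so the forward Lipschitz estimate bounds how fast
  points with a common past separate. The letters with $a \le |q| \le a^{3/2}$ suffice: for
  $\epsilon = \frac12 \log\log a / \log a$ their sum is at least of order
  $(a^{3/2})^{-\epsilon} \log a = (\log a)^{1/4}$. Subtracting
  $\log\log\log a / \log a$ makes the inequality strict.
\<close>

section \<open>Covers and Hausdorff dimension\<close>

text \<open>
  An upper bound \<open>c\<close> for the Hausdorff content without restriction on the diameters. Being a
  relation and not an infimum, it passes to countable unions and preimages without error terms;
  and sets of content zero have measure zero for every restriction on the diameters
  (\<open>hausdorff_dim_le\<close>).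
\<close>
definition covered :: "real \<Rightarrow> 'a::metric_space set \<Rightarrow> ennreal \<Rightarrow> bool" where
  "covered s A c \<longleftrightarrow>
     (\<exists>U :: nat \<Rightarrow> 'a set. A \<subseteq> (\<Union>i. U i) \<and> (\<forall>i. bounded (U i)) \<and>
        (\<Sum>i. ennreal (diameter (U i) powr s)) \<le> c)"

lemma diameter_leI:
  fixes S :: "'a::metric_space set"
  assumes "0 \<le> r" "\<And>x y. x \<in> S \<Longrightarrow> y \<in> S \<Longrightarrow> dist x y \<le> r"
  shows "diameter S \<le> r"
  using assms by (auto simp: diameter_def intro!: cSUP_least)

lemma covered_mono:
  assumes "covered s A c" "B \<subseteq> A" "c \<le> c'"
  shows "covered s B c'"
  using assms unfolding covered_def by (meson order_trans)

lemma covered_bounded: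
  fixes A :: "'a::metric_space set"
  assumes "bounded A" "diameter A \<le> r" "0 \<le> s"
  shows "covered s A (ennreal (r powr s))"
  unfolding covered_def
proof (intro exI conjI allI)
  let ?U = "\<lambda>i::nat. if i = 0 then A else {}"
  show "A \<subseteq> (\<Union>i. ?U i)" by auto
  show "bounded (?U i)" for i using assms by auto
  have "(\<Sum>i. ennreal (diameter (?U i) powr s)) = (\<Sum>i\<in>{0}. ennreal (diameter (?U i) powr s))"
    by (rule suminf_finite) auto
  also have "\<dots> \<le> ennreal (r powr s)"
    using assms diameter_ge_0[of A] by (auto intro!: ennreal_leI powr_mono2)
  finally show "(\<Sum>i. ennreal (diameter (?U i) powr s)) \<le> ennreal (r powr s)" .
qed

lemma covered_UN_nat:
  fixes A :: "nat \<Rightarrow> 'a::metric_space set"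
  assumes "\<And>i. covered s (A i) (c i)"
  shows "covered s (\<Union>i. A i) (\<Sum>i. c i)"
proof -
  have "\<forall>i. \<exists>U. A i \<subseteq> (\<Union>j::nat. U j) \<and> (\<forall>j. bounded (U j)) \<and>
      (\<Sum>j. ennreal (diameter (U j) powr s)) \<le> c i"
    using assms unfolding covered_def by blast
  then obtain U where U: "\<And>i. A i \<subseteq> (\<Union>j::nat. U i j)" "\<And>i j. bounded (U i j)"
      "\<And>i. (\<Sum>j. ennreal (diameter (U i j) powr s)) \<le> c i"
    by metis
  define V where "V n = case_prod U (prod_decode n)" for n
  have "(\<Union>i. A i) \<subseteq> (\<Union>n. V n)"
  proof
    fix x assume "x \<in> (\<Union>i. A i)"
    then obtain i j where "x \<in> U i j" using U(1) by blast
    then have "x \<in> V (prod_encode (i, j))" by (simp add: V_def)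
    then show "x \<in> (\<Union>n. V n)" by blast
  qed
  moreover have "bounded (V n)" for n using U(2) by (simp add: V_def split: prod.split)
  moreover have "(\<Sum>n. ennreal (diameter (V n) powr s)) \<le> (\<Sum>i. c i)"
  proof -
    have "(\<Sum>n. ennreal (diameter (V n) powr s)) =
        (\<Sum>n. (\<lambda>(i, j). ennreal (diameter (U i j) powr s)) (prod_decode n))"
      by (simp add: V_def case_prod_beta)
    also have "\<dots> = (\<Sum>i. \<Sum>j. ennreal (diameter (U i j) powr s))"
      by (rule suminf_ennreal_2dimen) simp
    also have "\<dots> \<le> (\<Sum>i. c i)" by (intro suminf_le U(3)) auto
    finally show ?thesis .
  qed
  ultimately show ?thesis unfolding covered_def by blast
qed

lemma covered_empty: "covered s {} c"
  unfolding covered_def by (intro exI[of _ "\<lambda>_. {}"]) auto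

text \<open>
  The sum over the index type is an integral for the counting measure, so that the lattice sums
  below need no enumeration of the lattice.
\<close>
lemma covered_UN:
  fixes A :: "'i::countable \<Rightarrow> 'a::metric_space set"
  assumes "\<And>i. covered s (A i) (c i)"
  shows "covered s (\<Union>i. A i) (\<integral>\<^sup>+ i. c i \<partial>count_space UNIV)"
proof -
  let ?R = "range (to_nat :: 'i \<Rightarrow> nat)"
  define B where "B n = (if n \<in> ?R then A (from_nat n) else {})" for n
  define e where "e n = (if n \<in> ?R then c (from_nat n) else 0)" for n
  have "covered s (B n) (e n)" for n
    using assms covered_empty by (auto simp: B_def e_def)
  then have "covered s (\<Union>n. B n) (\<Sum>n. e n)" by (rule covered_UN_nat)
  moreover have "(\<Union>i. A i) \<subseteq> (\<Union>n. B n)"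
    by (auto simp: B_def intro: exI[of _ "to_nat _"])
  moreover have "(\<Sum>n. e n) = (\<integral>\<^sup>+ i. c i \<partial>count_space UNIV)"
  proof -
    have "(\<Sum>n. e n) = (\<integral>\<^sup>+ n. e n \<partial>count_space UNIV)"
      by (simp add: nn_integral_count_space_nat)
    also have "\<dots> = (\<integral>\<^sup>+ n. e n \<partial>count_space ?R)"
      by (rule nn_integral_count_space_eq) (auto simp: e_def)
    also have "\<dots> = (\<integral>\<^sup>+ i. e (to_nat i) \<partial>count_space (UNIV :: 'i set))"
      by (rule nn_integral_bij_count_space[symmetric]) (simp add: inj_on_imp_bij_betw)
    finally show ?thesis by (simp add: e_def)
  qed
  ultimately show ?thesis using covered_mono by fastforce
qed

text \<open>
  A cover of the image pulls back: a map that expands distances by at least \<open>1 / L\<close> on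
  \<open>A\<close> has an inverse there with Lipschitz constant \<open>L\<close>, and the pieces \<open>A \<inter> f -` U i\<close> cover \<open>A\<close>.
\<close>
lemma covered_expanding_preimage:
  fixes A :: "'a::metric_space set" and f :: "'a \<Rightarrow> 'b::metric_space"
  assumes "covered s (f ` A) c" "0 \<le> L" "0 \<le> s"
    and expand: "\<And>x y. x \<in> A \<Longrightarrow> y \<in> A \<Longrightarrow> dist x y \<le> L * dist (f x) (f y)"
  shows "covered s A (ennreal (L powr s) * c)"
proof -
  obtain U :: "nat \<Rightarrow> 'b set" where U: "f ` A \<subseteq> (\<Union>i. U i)" "\<And>i. bounded (U i)"
      "(\<Sum>i. ennreal (diameter (U i) powr s)) \<le> c"
    using assms(1) unfolding covered_def by blast
  define V where "V i = A \<inter> f -` U i" for i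
  have dist_V: "dist x y \<le> L * diameter (U i)" if "x \<in> V i" "y \<in> V i" for x y i
  proof -
    have "dist x y \<le> L * dist (f x) (f y)" using that expand by (auto simp: V_def)
    also have "\<dots> \<le> L * diameter (U i)"
      using that U(2) assms(2)
      by (intro mult_left_mono diameter_bounded_bound) (auto simp: V_def)
    finally show ?thesis .
  qed
  have "bounded (V i)" for i
    using dist_V[of _ i] unfolding bounded_def by (cases "V i = {}") blast+
  moreover have "A \<subseteq> (\<Union>i. V i)" using U(1) unfolding V_def by blast
  moreover have "(\<Sum>i. ennreal (diameter (V i) powr s)) \<le> ennreal (L powr s) * c"
  proof -
    have "(\<Sum>i. ennreal (diameter (V i) powr s)) \<le>
        (\<Sum>i. ennreal (L powr s) * ennreal (diameter (U i) powr s))"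
    proof (intro suminf_le)
      fix i
      have "0 \<le> diameter (V i)" "0 \<le> diameter (U i)"
        using \<open>bounded (V i)\<close> U(2) by (auto intro: diameter_ge_0)
      moreover have "diameter (V i) \<le> L * diameter (U i)"
        using dist_V assms(2) \<open>0 \<le> diameter (U i)\<close> by (intro diameter_leI) auto
      ultimately have "diameter (V i) powr s \<le> (L * diameter (U i)) powr s"
        using assms(3) by (intro powr_mono2) auto
      also have "\<dots> = L powr s * diameter (U i) powr s"
        by (rule powr_mult)
      finally show "ennreal (diameter (V i) powr s) \<le>
          ennreal (L powr s) * ennreal (diameter (U i) powr s)"
        by (simp add: ennreal_leI flip: ennreal_mult)
    qed auto
    also have "\<dots> = ennreal (L powr s) * (\<Sum>i. ennreal (diameter (U i) powr s))"
      by simp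
    also have "\<dots> \<le> ennreal (L powr s) * c" by (intro mult_left_mono U(3)) auto
    finally show ?thesis .
  qed
  ultimately show ?thesis unfolding covered_def by blast
qed

lemma null_UN:
  fixes A :: "'i::countable \<Rightarrow> 'a::metric_space set"
  assumes "\<And>i \<epsilon>. 0 < \<epsilon> \<Longrightarrow> covered s (A i) (ennreal \<epsilon>)" "0 < \<epsilon>"
  shows "covered s (\<Union>i. A i) (ennreal \<epsilon>)"
proof -
  have "covered s (\<Union>n. A (from_nat n)) (\<Sum>n. ennreal (\<epsilon> * (1 / 2) ^ Suc n))"
    using assms by (intro covered_UN_nat) auto
  moreover have "(\<Sum>n. ennreal (\<epsilon> * (1 / 2) ^ Suc n)) = ennreal \<epsilon>"
    using assms(2) sums_mult[OF power_half_series, of \<epsilon>]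
    by (subst suminf_ennreal_eq[where x="\<epsilon> * 1"]) (auto simp del: power_Suc)
  moreover have "A i \<subseteq> (\<Union>n. A (from_nat n))" for i
    using UN_upper[of "to_nat i" UNIV "\<lambda>n. A (from_nat n)"] by simp
  then have "(\<Union>i. A i) \<subseteq> (\<Union>n. A (from_nat n))" by (rule UN_least)
  ultimately show ?thesis using covered_mono by fastforce
qed

text \<open>
  A cover with small sum consists of small sets, since each single summand bounds a diameter; thus
  the restriction on the diameters in the Hausdorff measure is met automatically.
\<close>
lemma hausdorff_dim_le:
  fixes A :: "'a::metric_space set"
  assumes "0 < s" and null: "\<And>\<epsilon>. 0 < \<epsilon> \<Longrightarrow> covered s A (ennreal \<epsilon>)"
  shows "hausdorff_dim A \<le> ereal s"
proof -
  have "hausdorff_content \<delta> s A \<le> 0" if "0 < \<delta>" for \<delta>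
  proof (rule ennreal_le_epsilon)
    fix e :: real assume "0 < e"
    define \<epsilon> where "\<epsilon> = min e (\<delta> powr s)"
    have "0 < \<epsilon>" using \<open>0 < e\<close> that by (simp add: \<epsilon>_def)
    then obtain U :: "nat \<Rightarrow> 'a set" where U: "A \<subseteq> (\<Union>i. U i)" "\<And>i. bounded (U i)"
      "(\<Sum>i. ennreal (diameter (U i) powr s)) \<le> ennreal \<epsilon>"
      using null[of \<epsilon>] unfolding covered_def by blast
    have diam: "diameter (U i) \<le> \<delta>" for i
    proof -
      have "ennreal (diameter (U i) powr s) = (\<Sum>j\<in>{i}. ennreal (diameter (U j) powr s))" by simp
      also have "\<dots> \<le> (\<Sum>i. ennreal (diameter (U i) powr s))" by (rule sum_le_suminf) auto
      also have "\<dots> \<le> ennreal (\<delta> powr s)" 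
        using U(3) by (rule order_trans) (simp add: \<epsilon>_def ennreal_leI)
      finally have "diameter (U i) powr s \<le> \<delta> powr s" by (simp add: ennreal_le_iff)
      then show ?thesis
        using that \<open>0 < s\<close> by (meson linorder_not_less powr_less_mono2 less_imp_le)
    qed
    have "hausdorff_content \<delta> s A \<le> (\<Sum>i. diam_power s (U i))"
      unfolding hausdorff_content_def using U diam by (intro INF_lower) auto
    also have "\<dots> \<le> (\<Sum>i. ennreal (diameter (U i) powr s))"
      using \<open>0 < s\<close> by (intro suminf_le) (auto simp: diam_power_def)
    also have "\<dots> \<le> ennreal e" using U(3) by (rule order_trans) (simp add: \<epsilon>_def ennreal_leI)
    finally show "hausdorff_content \<delta> s A \<le> 0 + ennreal e" by simp
  qed
  then have "hausdorff_measure s A \<le> 0"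
    unfolding hausdorff_measure_def by (intro SUP_least) auto
  then have "s \<in> {s. 0 \<le> s \<and> hausdorff_measure s A = 0}" using \<open>0 < s\<close> by simp
  then show ?thesis unfolding hausdorff_dim_def by (rule INF_lower)
qed

lemma hausdorff_dim_mono:
  fixes A :: "'a::metric_space set"
  assumes "A \<subseteq> B"
  shows "hausdorff_dim A \<le> hausdorff_dim B"
proof -
  have "hausdorff_content \<delta> s A \<le> hausdorff_content \<delta> s B" for \<delta> s
    unfolding hausdorff_content_def using assms by (intro INF_superset_mono) auto
  then have "hausdorff_measure s A \<le> hausdorff_measure s B" for s
    unfolding hausdorff_measure_def by (intro SUP_mono) blast
  then have "hausdorff_measure s B = 0 \<Longrightarrow> hausdorff_measure s A = 0" for s
    by (metis le_zero_eq)
  then show ?thesis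
    unfolding hausdorff_dim_def by (intro INF_superset_mono) auto
qed

text \<open>
  For sets of diameter at most 1 the power with exponent \<open>s\<close> is at most the power with any
  smaller exponent, so one bound at \<open>s\<close> excludes all \<open>t < s\<close>; the case \<open>t = 0\<close> is separate
  because of the convention for the zeroth power.
\<close>
lemma hausdorff_dim_ge:
  fixes A :: "'a::metric_space set"
  assumes "0 < s" "0 < c"
    and mass: "\<And>U :: nat \<Rightarrow> 'a set. A \<subseteq> (\<Union>i. U i) \<Longrightarrow> (\<And>i. bounded (U i)) \<Longrightarrow>
        c \<le> (\<Sum>i. ennreal (diameter (U i) powr s))"
  shows "ereal s \<le> hausdorff_dim A"
  unfolding hausdorff_dim_def
proof (rule INF_greatest)
  fix t assume "t \<in> {t. 0 \<le> t \<and> hausdorff_measure t A = 0}"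
  then have t: "0 \<le> t" "hausdorff_measure t A = 0" by auto
  show "ereal s \<le> ereal t"
  proof (rule ccontr)
    assume "\<not> ereal s \<le> ereal t"
    then have "t < s" by simp
    have "c \<le> hausdorff_content 1 t A"
      unfolding hausdorff_content_def
    proof (rule INF_greatest)
      fix U :: "nat \<Rightarrow> 'a set"
      assume "U \<in> {U. A \<subseteq> (\<Union>i. U i) \<and> (\<forall>i. bounded (U i) \<and> diameter (U i) \<le> 1)}"
      then have U: "A \<subseteq> (\<Union>i. U i)" "\<And>i. bounded (U i)" "\<And>i. diameter (U i) \<le> 1" by auto
      have "ennreal (diameter (U i) powr s) \<le> diam_power t (U i)" for i
      proof (cases "t = 0")
        case True
        then show ?thesis
          using U(3)[of i] diameter_ge_0[OF U(2)[of i]] \<open>0 < s\<close>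
          by (auto simp: diam_power_def intro!: powr_le1)
      next
        case False
        then show ?thesis
          using U(3)[of i] diameter_ge_0[OF U(2)[of i]] \<open>t < s\<close>
          by (auto simp: diam_power_def intro!: ennreal_leI powr_mono')
      qed
      then have "(\<Sum>i. ennreal (diameter (U i) powr s)) \<le> (\<Sum>i. diam_power t (U i))"
        by (intro suminf_le) auto
      then show "c \<le> (\<Sum>i. diam_power t (U i))"
        using mass[OF U(1,2)] by (meson order_trans)
    qed
    also have "\<dots> \<le> hausdorff_measure t A"
      unfolding hausdorff_measure_def by (intro SUP_upper) simp
    finally show False using t \<open>0 < c\<close> by simp
  qed
qed

section \<open>Mass distribution on symbolically coded sets\<close>

text \<open>
  The points that follow the first \<open>n\<close> letters form a decreasing sequence of compact sets, which
  are nonempty because the finite itinerary can be realised backwards from its last letter.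
\<close>
lemma itinerary_exists:
  fixes f :: "'a::heine_borel \<Rightarrow> 'a" and P :: "'q \<Rightarrow> 'a set"
  assumes P: "\<And>q. q \<in> E \<Longrightarrow> compact (P q)" "\<And>q. q \<in> E \<Longrightarrow> P q \<noteq> {}"
    and f: "\<And>q. q \<in> E \<Longrightarrow> continuous_on (P q) f"
    and onto: "\<And>q q'. q \<in> E \<Longrightarrow> q' \<in> E \<Longrightarrow> P q' \<subseteq> f ` P q"
    and \<omega>: "\<And>n::nat. \<omega> n \<in> E"
  shows "\<exists>x. \<forall>n. (f ^^ n) x \<in> P (\<omega> n)"
proof -
  define K where "K \<omega> n = {x. \<forall>i\<le>n. (f ^^ i) x \<in> P (\<omega> i)}" for \<omega> :: "nat \<Rightarrow> 'q" and n
  have K_Suc: "K \<omega> (Suc n) = P (\<omega> 0) \<inter> f -` K (\<omega> \<circ> Suc) n" for \<omega> n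
  proof -
    have "(\<forall>i\<le>Suc n. Q i) \<longleftrightarrow> Q 0 \<and> (\<forall>i\<le>n. Q (Suc i))" for Q
      by (metis Suc_le_mono le0 not0_implies_Suc)
    then show ?thesis
      by (auto simp: K_def funpow_Suc_right simp del: funpow.simps)
  qed
  have K: "compact (K \<omega> n) \<and> K \<omega> n \<noteq> {}" if "\<And>n. \<omega> n \<in> E" for \<omega> n
    using that
  proof (induction n arbitrary: \<omega>)
    case 0
    then show ?case using P by (simp add: K_def)
  next
    case (Suc n)
    then have IH: "compact (K (\<omega> \<circ> Suc) n)" "K (\<omega> \<circ> Suc) n \<noteq> {}" by auto
    have cl: "closed (K \<omega> (Suc n))"
      unfolding K_Suc using P f Suc.prems IH
      by (intro continuous_closed_preimage) (auto intro: compact_imp_closed)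
    have "K \<omega> (Suc n) = P (\<omega> 0) \<inter> K \<omega> (Suc n)" unfolding K_Suc by auto
    then have "compact (K \<omega> (Suc n))"
      using compact_Int_closed[OF P(1)[OF Suc.prems[of 0]] cl] by simp
    moreover obtain y where y: "y \<in> K (\<omega> \<circ> Suc) n" using IH by blast
    then have "y \<in> P (\<omega> (Suc 0))" by (auto simp: K_def)
    then obtain x where "x \<in> P (\<omega> 0)" "f x = y"
      using onto[OF Suc.prems[of 0] Suc.prems[of "Suc 0"]] by blast
    then have "x \<in> K \<omega> (Suc n)" using y by (simp add: K_Suc)
    ultimately show ?case by blast
  qed
  have "\<Inter> (range (K \<omega>)) \<noteq> {}"
  proof (rule compact_nest)
    show "compact (K \<omega> n)" "K \<omega> n \<noteq> {}" for n using K[of \<omega> n] \<omega> by auto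
    show "K \<omega> n \<subseteq> K \<omega> m" if "m \<le> n" for m n using that by (auto simp: K_def)
  qed
  then show ?thesis by (auto simp: K_def)
qed

text \<open>
  Mass distribution principle for a coded set. Letters are drawn independently with probabilities at
  most \<open>lam q powr - s\<close>. Two points at distance \<open>D\<close> stay together until their distance,
  which grows at most by the product of the \<open>lam\<close> along the orbit, reaches \<open>\<delta>\<close>. So the
  sequences that code points of a given set of diameter \<open>D\<close> lie in one cylinder, of mass at
  most a constant times \<open>D powr s\<close>.

  The expansion constant belongs to the letter of the image \<open>f x\<close>, which for Zorich maps is
  the letter that determines the derivative at \<open>x\<close>. The resulting shift by one letter
  costs only a factor \<open>Max (lam ` E)\<close>.
\<close>
lemma hausdorff_dim_ge_coded:
  fixes f :: "'a::metric_space \<Rightarrow> 'a" and P :: "'q \<Rightarrow> 'a set" and lam :: "'q \<Rightarrow> real"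
  assumes "finite E" "0 < s" "0 < \<delta>"
    and lam: "\<And>q. q \<in> E \<Longrightarrow> 2 \<le> lam q" "1 \<le> (\<Sum>q\<in>E. lam q powr - s)"
    and sep: "\<And>q q' x y. q \<in> E \<Longrightarrow> q' \<in> E \<Longrightarrow> q \<noteq> q' \<Longrightarrow> x \<in> P q \<Longrightarrow> y \<in> P q' \<Longrightarrow> \<delta> \<le> dist x y"
    and expand: "\<And>q q' x y. q \<in> E \<Longrightarrow> q' \<in> E \<Longrightarrow> x \<in> P q \<Longrightarrow> y \<in> P q \<Longrightarrow> f x \<in> P q' \<Longrightarrow>
        dist x y < \<delta> \<Longrightarrow> dist (f x) (f y) \<le> lam q' * dist x y"
    and coded: "\<And>\<omega> :: nat \<Rightarrow> 'q. (\<And>n. \<omega> n \<in> E) \<Longrightarrow> \<exists>x\<in>A. \<forall>n. (f ^^ n) x \<in> P (\<omega> n)"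
  shows "ereal s \<le> hausdorff_dim A"
proof -
  define Z where "Z = (\<Sum>q\<in>E. lam q powr - s)"
  define p where "p q = lam q powr - s / Z" for q
  have "1 \<le> Z" using lam(2) by (simp add: Z_def)
  then have "E \<noteq> {}" by (auto simp: Z_def)
  have p: "0 \<le> p q" "p q \<le> lam q powr - s" for q
    using \<open>1 \<le> Z\<close> by (auto simp: p_def divide_le_eq mult_le_cancel_left1)
  have p1: "p q \<le> 1" if "q \<in> E" for q
  proof -
    have "lam q powr - s \<le> 1 powr - s"
      using lam(1)[OF that] \<open>0 < s\<close> by (intro powr_mono2') auto
    then show ?thesis using p(2)[of q] by simp
  qed
  have "(\<Sum>q\<in>E. p q) = 1"
    using \<open>1 \<le> Z\<close> unfolding p_def sum_divide_distrib[symmetric] by (simp add: Z_def)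
  then have prob: "prob_space (point_measure E (\<lambda>q. ennreal (p q)))"
    using \<open>finite E\<close> p(1) by (intro prob_space_point_measure) (auto simp: sum_ennreal)
  define M where "M = (\<Pi>\<^sub>M i\<in>(UNIV :: nat set). point_measure E (\<lambda>q. ennreal (p q)))"
  interpret prob_space M unfolding M_def by (rule prob_space_PiM) (rule prob)
  have space_M: "\<omega> \<in> space M \<longleftrightarrow> (\<forall>n. \<omega> n \<in> E)" for \<omega>
    by (auto simp: M_def space_PiM space_point_measure PiE_def)
  define cyl where "cyl v n = {\<omega> \<in> space M. \<forall>i<n. \<omega> i = v i}" for v :: "nat \<Rightarrow> 'q" and n :: nat
  have cyl: "cyl v n \<in> sets M" "emeasure M (cyl v n) = ennreal (\<Prod>i<n. p (v i))"
    if "v \<in> space M" for v n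
  proof -
    have eq: "cyl v n = prod_emb UNIV (\<lambda>_. point_measure E (\<lambda>q. ennreal (p q))) {..<n}
        (\<Pi>\<^sub>E i\<in>{..<n}. {v i})"
      unfolding cyl_def prod_emb_def M_def space_PiM
      by (auto simp: PiE_def Pi_def extensional_def restrict_def)
    show "cyl v n \<in> sets M"
      unfolding eq M_def using that
      by (intro sets_PiM_I) (auto simp: sets_point_measure space_M)
    have "emeasure M (cyl v n) = (\<Prod>i<n. emeasure (point_measure E (\<lambda>q. ennreal (p q))) {v i})"
      unfolding eq M_def using that prob
      by (intro emeasure_PiM_emb) (auto simp: sets_point_measure space_M)
    also have "\<dots> = (\<Prod>i<n. ennreal (p (v i)))"
      using that \<open>finite E\<close> by (intro prod.cong) (auto simp: emeasure_point_measure_finite space_M)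
    finally show "emeasure M (cyl v n) = ennreal (\<Prod>i<n. p (v i))"
      using p(1) by (simp add: prod_ennreal)
  qed
  define \<pi> where "\<pi> \<omega> = (SOME x. x \<in> A \<and> (\<forall>n. (f ^^ n) x \<in> P (\<omega> n)))" for \<omega>
  have \<pi>: "\<pi> \<omega> \<in> A" "(f ^^ n) (\<pi> \<omega>) \<in> P (\<omega> n)" if "\<omega> \<in> space M" for \<omega> n
  proof -
    have "\<exists>x. x \<in> A \<and> (\<forall>n. (f ^^ n) x \<in> P (\<omega> n))"
      using coded[of \<omega>] that by (auto simp: space_M)
    from someI_ex[OF this] show "\<pi> \<omega> \<in> A" "(f ^^ n) (\<pi> \<omega>) \<in> P (\<omega> n)"
      by (auto simp: \<pi>_def)
  qed
  define b where "b = Max (lam ` E)"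
  have b: "lam q \<le> b" if "q \<in> E" for q using that \<open>finite E\<close> by (simp add: b_def)
  then have "2 \<le> b" using lam(1) \<open>E \<noteq> {}\<close> by (meson ex_in_conv order_trans)
  define K where "K = (b / \<delta>) powr s"
  have "0 < K" using \<open>2 \<le> b\<close> \<open>0 < \<delta>\<close> by (simp add: K_def)
  have key: "\<exists>C\<in>sets M. {\<omega> \<in> space M. \<pi> \<omega> \<in> U} \<subseteq> C \<and> emeasure M C \<le> ennreal (K * D powr s)"
    if U: "bounded U" "diameter U \<le> D" "0 < D" for U D
  proof (cases "{\<omega> \<in> space M. \<pi> \<omega> \<in> U} = {}")
    case True
    then show ?thesis by (intro bexI[of _ "{}"]) auto
  next
    case False
    then obtain v where v: "v \<in> space M" "\<pi> v \<in> U" by blast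
    then have vE: "v n \<in> E" for n by (simp add: space_M)
    \<comment> \<open>The largest possible growth of distances in \<open>n\<close> steps along the orbit of \<open>\<pi> v\<close>.\<close>
    define \<Lambda> where "\<Lambda> n = (\<Prod>i<n. lam (v (Suc i)))" for n
    have \<Lambda>_Suc: "\<Lambda> (Suc n) = \<Lambda> n * lam (v (Suc n))" for n by (simp add: \<Lambda>_def)
    have \<Lambda>_ge: "2 ^ n \<le> \<Lambda> n" for n
    proof -
      have "(\<Prod>i<n. 2) \<le> \<Lambda> n"
        unfolding \<Lambda>_def by (intro prod_mono) (simp add: lam(1)[OF vE])
      then show ?thesis by simp
    qed
    have \<Lambda>_pos: "0 < \<Lambda> n" for n using \<Lambda>_ge[of n] by (meson less_le_trans zero_less_numeral zero_less_power)
    have "\<exists>n. \<delta> \<le> \<Lambda> n * D"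
    proof -
      obtain n where "\<delta> / D < 2 ^ n" using real_arch_pow[of 2 "\<delta> / D"] by auto
      then have "\<delta> / D \<le> \<Lambda> n" using \<Lambda>_ge[of n] by linarith
      then show ?thesis using U(3) by (auto simp: divide_le_eq)
    qed
    \<comment> \<open>The time until which points of \<open>U\<close> cannot be separated from \<open>\<pi> v\<close>.\<close>
    define n where "n = (LEAST n. \<delta> \<le> \<Lambda> n * D)"
    have n: "\<delta> \<le> \<Lambda> n * D" unfolding n_def by (rule LeastI_ex) fact
    have less_n: "\<Lambda> j * D < \<delta>" if "j < n" for j
      using that not_less_Least unfolding n_def by (metis not_le)
    have "\<omega> \<in> cyl v n" if "\<omega> \<in> space M" "\<pi> \<omega> \<in> U" for \<omega>
    proof -
      have \<omega>E: "\<omega> i \<in> E" for i using that by (simp add: space_M)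
      have same: "\<omega> j = v j"
        if "dist ((f ^^ j) (\<pi> v)) ((f ^^ j) (\<pi> \<omega>)) \<le> \<Lambda> j * D" "j < n" for j
      proof (rule ccontr)
        assume "\<omega> j \<noteq> v j"
        then have "\<delta> \<le> dist ((f ^^ j) (\<pi> v)) ((f ^^ j) (\<pi> \<omega>))"
          using sep[OF vE \<omega>E not_sym \<pi>(2)[OF v(1)] \<pi>(2)[OF \<open>\<omega> \<in> space M\<close>]] by blast
        then show False using that(1) less_n[OF that(2)] by linarith
      qed
      have "dist ((f ^^ j) (\<pi> v)) ((f ^^ j) (\<pi> \<omega>)) \<le> \<Lambda> j * D" if "j < n" for j
        using that
      proof (induction j)
        case 0
        have "dist (\<pi> v) (\<pi> \<omega>) \<le> diameter U"
          using U v \<open>\<pi> \<omega> \<in> U\<close> by (intro diameter_bounded_bound)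
        then show ?case using U(2) by (simp add: \<Lambda>_def)
      next
        case (Suc j)
        then have IH: "dist ((f ^^ j) (\<pi> v)) ((f ^^ j) (\<pi> \<omega>)) \<le> \<Lambda> j * D" and "j < n" by auto
        have "dist (f ((f ^^ j) (\<pi> v))) (f ((f ^^ j) (\<pi> \<omega>)))
            \<le> lam (v (Suc j)) * dist ((f ^^ j) (\<pi> v)) ((f ^^ j) (\<pi> \<omega>))"
        proof (rule expand)
          show "(f ^^ j) (\<pi> v) \<in> P (v j)" "f ((f ^^ j) (\<pi> v)) \<in> P (v (Suc j))"
            using \<pi>(2)[OF v(1), of j] \<pi>(2)[OF v(1), of "Suc j"] by auto
          show "(f ^^ j) (\<pi> \<omega>) \<in> P (v j)"
            using \<pi>(2)[OF \<open>\<omega> \<in> space M\<close>, of j] same[OF IH \<open>j < n\<close>] by simp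
        qed (use vE IH less_n[OF \<open>j < n\<close>] in auto)
        also have "\<dots> \<le> lam (v (Suc j)) * (\<Lambda> j * D)"
          using IH lam(1)[OF vE[of "Suc j"]] by (intro mult_left_mono) auto
        finally show ?case by (simp add: \<Lambda>_Suc mult_ac)
      qed
      then show ?thesis using that(1) same by (auto simp: cyl_def)
    qed
    moreover have "(\<Prod>i<n. p (v i)) \<le> K * D powr s"
    proof (cases n)
      case 0
      have "1 * D \<le> b * D" using \<open>2 \<le> b\<close> U(3) by (intro mult_right_mono) auto
      moreover have "\<delta> \<le> D" using n 0 by (simp add: \<Lambda>_def)
      ultimately have "\<delta> \<le> b * D" by linarith
      then have "1 \<le> b * D / \<delta>" using \<open>0 < \<delta>\<close> by simp
      then have "1 \<le> (b * D / \<delta>) powr s" using \<open>0 < s\<close> by (intro ge_one_powr_ge_zero) auto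
      also have "\<dots> = K * D powr s"
        unfolding K_def by (subst powr_mult[symmetric]) (simp add: mult_ac)
      finally show ?thesis using 0 by simp
    next
      case (Suc k)
      have "(\<Prod>i<n. p (v i)) = p (v 0) * (\<Prod>i<k. p (v (Suc i)))"
        unfolding Suc by (rule prod.lessThan_Suc_shift)
      also have "\<dots> \<le> 1 * (\<Prod>i<k. lam (v (Suc i)) powr - s)"
        using p p1 vE by (intro mult_mono prod_mono prod_nonneg) auto
      also have "\<dots> = \<Lambda> k powr - s"
        unfolding \<Lambda>_def using lam(1)[OF vE]
        by (simp add: prod_powr_distrib)
      also have "\<dots> \<le> (\<delta> / (b * D)) powr - s"
      proof (rule powr_mono2')
        have "\<Lambda> n * D \<le> \<Lambda> k * b * D"
          unfolding Suc \<Lambda>_Suc using \<Lambda>_pos[of k] b[OF vE] U(3)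
          by (intro mult_right_mono mult_left_mono) auto
        then have "\<delta> \<le> \<Lambda> k * (b * D)" using n by (simp add: mult.assoc)
        then show "\<delta> / (b * D) \<le> \<Lambda> k"
          using U(3) \<open>2 \<le> b\<close> by (subst pos_divide_le_eq) auto
      qed (use U(3) \<open>2 \<le> b\<close> \<open>0 < \<delta>\<close> \<open>0 < s\<close> in auto)
      also have "\<dots> = (b * D / \<delta>) powr s"
        by (simp add: powr_minus powr_divide)
      also have "\<dots> = K * D powr s"
        unfolding K_def by (subst powr_mult[symmetric]) (simp add: mult_ac)
      finally show ?thesis .
    qed
    ultimately show ?thesis
      using cyl[OF v(1), of n] by (intro bexI[of _ "cyl v n"]) (auto intro!: ennreal_leI)
  qed
  show ?thesis
  proof (rule hausdorff_dim_ge[OF \<open>0 < s\<close>])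
    show "0 < ennreal (1 / K)" using \<open>0 < K\<close> by simp
    fix U :: "nat \<Rightarrow> 'a set" assume U: "A \<subseteq> (\<Union>i. U i)" "\<And>i. bounded (U i)"
    let ?S = "\<Sum>i. ennreal (diameter (U i) powr s)"
    \<comment> \<open>A set of diameter zero is treated as a set of small positive diameter \<open>D i\<close>, where the
        summands \<open>e i\<close> pay for the enlargement.\<close>
    have "1 \<le> ennreal K * ?S"
    proof (rule ennreal_le_epsilon)
      fix \<epsilon> :: real assume "0 < \<epsilon>"
      define e where "e i = (\<epsilon> / K) * (1 / 2) ^ Suc i" for i
      have e: "0 < e i" for i using \<open>0 < \<epsilon>\<close> \<open>0 < K\<close> by (simp add: e_def)
      define D where "D i = (diameter (U i) powr s + e i) powr (1 / s)" for i
      have diam0: "0 \<le> diameter (U i)" for i using U(2) by (rule diameter_ge_0)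
      have D: "0 < D i" "diameter (U i) \<le> D i" "D i powr s = diameter (U i) powr s + e i" for i
      proof -
        have pos: "0 < diameter (U i) powr s + e i"
          using e[of i] by (simp add: add_nonneg_pos)
        then show "0 < D i" by (simp add: D_def)
        show "D i powr s = diameter (U i) powr s + e i"
          using pos \<open>0 < s\<close> by (simp add: D_def powr_powr)
        then have "diameter (U i) powr s \<le> D i powr s" using e[of i] by simp
        then show "diameter (U i) \<le> D i"
          using \<open>0 < s\<close> \<open>0 < D i\<close> by (meson linorder_not_less powr_less_mono2 less_imp_le)
      qed
      have "\<exists>C. C \<in> sets M \<and> {\<omega> \<in> space M. \<pi> \<omega> \<in> U i} \<subseteq> C \<and>
          emeasure M C \<le> ennreal (K * D i powr s)" for i
        using key[OF U(2) D(2) D(1)] by blast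
      then obtain C where "\<forall>i. C i \<in> sets M \<and> {\<omega> \<in> space M. \<pi> \<omega> \<in> U i} \<subseteq> C i \<and>
          emeasure M (C i) \<le> ennreal (K * D i powr s)"
        using choice[of "\<lambda>i C. C \<in> sets M \<and> {\<omega> \<in> space M. \<pi> \<omega> \<in> U i} \<subseteq> C \<and>
          emeasure M C \<le> ennreal (K * D i powr s)"] by blast
      then have C: "\<And>i. C i \<in> sets M" "\<And>i. {\<omega> \<in> space M. \<pi> \<omega> \<in> U i} \<subseteq> C i"
          "\<And>i. emeasure M (C i) \<le> ennreal (K * D i powr s)"
        by auto
      have "space M \<subseteq> (\<Union>i. C i)"
      proof
        fix \<omega> assume "\<omega> \<in> space M"
        moreover then obtain i where "\<pi> \<omega> \<in> U i" using U(1) \<pi>(1) by blast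
        ultimately show "\<omega> \<in> (\<Union>i. C i)" using C(2) by blast
      qed
      then have "1 \<le> emeasure M (\<Union>i. C i)"
        using emeasure_mono[of "space M" "\<Union>i. C i" M] C(1) by (auto simp: emeasure_space_1)
      also have "\<dots> \<le> (\<Sum>i. emeasure M (C i))"
        using C(1) by (intro emeasure_subadditive_countably) auto
      also have "\<dots> \<le> (\<Sum>i. ennreal K * ennreal (diameter (U i) powr s) + ennreal (K * e i))"
        using C(3) D(3) e \<open>0 < K\<close>
        by (intro suminf_le) (auto simp: distrib_left ennreal_plus ennreal_mult less_imp_le)
      also have "\<dots> = ennreal K * ?S + (\<Sum>i. ennreal (K * e i))"
        by (simp add: suminf_add[symmetric])
      also have "(\<Sum>i. ennreal (K * e i)) = ennreal \<epsilon>"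
        using \<open>0 < K\<close> \<open>0 < \<epsilon>\<close> sums_mult[OF power_half_series, of \<epsilon>]
        by (subst suminf_ennreal_eq[where x="\<epsilon> * 1"]) (auto simp: e_def simp del: power_Suc)
      finally show "1 \<le> ennreal K * ?S + ennreal \<epsilon>" .
    qed
    then have "ennreal (1 / K) * 1 \<le> ennreal (1 / K) * (ennreal K * ?S)"
      by (intro mult_left_mono) auto
    also have "\<dots> = ?S"
      using \<open>0 < K\<close> by (simp add: mult.assoc[symmetric] ennreal_mult[symmetric])
    finally show "ennreal (1 / K) \<le> ?S" by simp
  qed
qed

section \<open>Metric geometry of a Zorich map\<close>

definition cell :: "real \<Rightarrow> ('n \<Rightarrow> int) \<Rightarrow> ('n::finite) space set" where
  "cell \<rho> q = {x. \<forall>j. \<bar>fst x $ j - 2 * \<rho> * of_int (q j)\<bar> \<le> \<rho>}"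

text \<open>
  The isometry of the base of the cell onto the cube that undoes the reflections.
\<close>
definition fold_cell :: "real \<Rightarrow> ('n \<Rightarrow> int) \<Rightarrow> ('n::finite) space \<Rightarrow> real ^ 'n" where
  "fold_cell \<rho> q x = (\<chi> j. (-1) powi (q j) * (fst x $ j - 2 * \<rho> * of_int (q j)))"

lemma abs_minus_one_powi [simp]: "\<bar>(-1 :: real) powi k\<bar> = 1"
  by (cases "even k") (auto simp: power_int_minus_left)

lemma closed_cell: "closed (cell \<rho> q)"
  unfolding cell_def by (intro closed_Collect_all closed_Collect_le continuous_intros)

lemma fold_cell_in_cube: "x \<in> cell \<rho> q \<Longrightarrow> fold_cell \<rho> q x \<in> cube \<rho>"
  by (simp add: cell_def cube_def fold_cell_def abs_mult)

lemma dist_fold_cell: "dist (fold_cell \<rho> q x) (fold_cell \<rho> q y) = dist (fst x) (fst y)"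
  by (simp add: dist_vec_def fold_cell_def dist_real_def abs_mult right_diff_distrib[symmetric])

lemma norm_reflect_pow: "norm (reflect_pow k y) = norm y"
  by (simp add: reflect_pow_def norm_prod_def abs_mult)

lemma dist_reflect_pow: "dist (reflect_pow k x) (reflect_pow k y) = dist x y"
  by (simp add: reflect_pow_def dist_prod_def dist_real_def abs_mult
      right_diff_distrib[symmetric])

text \<open>
  Polar coordinates: radial and angular parts of the distance separate exactly.
\<close>
lemma dist_polar:
  fixes u v :: "'a::real_inner"
  assumes "norm u = 1" "norm v = 1"
  shows "(dist (r *\<^sub>R u) (t *\<^sub>R v))\<^sup>2 = (r - t)\<^sup>2 + r * t * (dist u v)\<^sup>2"
proof -
  have "u \<bullet> u = 1" "v \<bullet> v = 1" using assms by (simp_all add: norm_eq_1)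
  then show ?thesis
    unfolding dist_norm power2_norm_eq_inner
    by (simp add: inner_diff_left inner_diff_right inner_commute[of v u] power2_eq_square algebra_simps)
qed

lemma exp_diff_bounds:
  fixes t u :: real
  shows "exp (min t u) * \<bar>t - u\<bar> \<le> \<bar>exp t - exp u\<bar>" "\<bar>exp t - exp u\<bar> \<le> exp (max t u) * \<bar>t - u\<bar>"
proof -
  have *: "exp u * (t - u) \<le> exp t - exp u \<and> exp t - exp u \<le> exp t * (t - u)" if "u \<le> t" for t u :: real
  proof -
    have "exp u * (1 + (t - u)) \<le> exp u * exp (t - u)"
      by (intro mult_left_mono exp_ge_add_one_self) auto
    moreover have "exp t * (1 + (u - t)) \<le> exp t * exp (u - t)"
      by (intro mult_left_mono exp_ge_add_one_self) auto
    ultimately show ?thesis by (simp add: algebra_simps flip: exp_add)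
  qed
  show "exp (min t u) * \<bar>t - u\<bar> \<le> \<bar>exp t - exp u\<bar>" "\<bar>exp t - exp u\<bar> \<le> exp (max t u) * \<bar>t - u\<bar>"
    using *[of u t] *[of t u] by (cases "u \<le> t"; simp add: min_def max_def abs_if)+
qed

text \<open>
  One constant \<open>L\<close> serves for \<open>h\<close> and for its inverse. It is taken at least 1 so that it also
  covers the radial direction, which \<open>F\<close> does not distort.
\<close>
locale zorich =
  fixes \<rho> :: real and h :: "real ^ 'n::finite \<Rightarrow> 'n space" and F :: "'n space \<Rightarrow> 'n space"
    and L :: real
  assumes zorich_map: "zorich_map \<rho> h F"
    and L_ge_1: "1 \<le> L"
    and h_lower: "\<And>x y. x \<in> cube \<rho> \<Longrightarrow> y \<in> cube \<rho> \<Longrightarrow> dist x y \<le> L * dist (h x) (h y)"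
    and h_upper: "\<And>x y. x \<in> cube \<rho> \<Longrightarrow> y \<in> cube \<rho> \<Longrightarrow> dist (h x) (h y) \<le> L * dist x y"
begin

lemma \<rho>_pos: "0 < \<rho>" and h_onto: "h ` cube \<rho> = upper_hemisphere"
  using zorich_map by (simp_all add: zorich_map_def)

lemma F_cell:
  assumes "x \<in> cell \<rho> q"
  shows "F x = reflect_pow (\<Sum>j\<in>UNIV. q j) (exp (snd x) *\<^sub>R h (fold_cell \<rho> q x))"
  using zorich_map assms unfolding zorich_map_def cell_def fold_cell_def by blast

lemma norm_h: "x \<in> cube \<rho> \<Longrightarrow> norm (h x) = 1"
  using h_onto by (auto simp: upper_hemisphere_def)

lemma in_some_cell: "\<exists>q. x \<in> cell \<rho> q"
proof
  define z where "z j = (fst x $ j + \<rho>) / (2 * \<rho>)" for j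
  have z: "fst x $ j - 2 * \<rho> * \<lfloor>z j\<rfloor> = 2 * \<rho> * (z j - \<lfloor>z j\<rfloor>) - \<rho>" for j
    using \<rho>_pos by (simp add: z_def field_simps)
  have "\<bar>fst x $ j - 2 * \<rho> * \<lfloor>z j\<rfloor>\<bar> \<le> \<rho>" for j
  proof -
    have "0 \<le> z j - \<lfloor>z j\<rfloor>" "z j - \<lfloor>z j\<rfloor> \<le> 1" by linarith+
    then have "0 \<le> 2 * \<rho> * (z j - \<lfloor>z j\<rfloor>)" "2 * \<rho> * (z j - \<lfloor>z j\<rfloor>) \<le> 2 * \<rho> * 1"
      using \<rho>_pos by (auto intro!: mult_left_mono)
    then show ?thesis unfolding z by linarith
  qed
  then show "x \<in> cell \<rho> (\<lambda>j. \<lfloor>z j\<rfloor>)" by (simp add: cell_def)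
qed

lemma norm_F: "norm (F x) = exp (snd x)"
proof -
  obtain q where "x \<in> cell \<rho> q" using in_some_cell by blast
  then show ?thesis using norm_h[OF fold_cell_in_cube] by (simp add: F_cell norm_reflect_pow)
qed

text \<open>
  By \<open>dist_polar\<close> the squared distance of the images is the squared difference of the radii
  plus the squared distance of the angles times the product of the radii. The former is compared with
  \<open>snd\<close> by \<open>exp_diff_bounds\<close>, the latter with \<open>fst\<close> because \<open>h\<close> is bi-Lipschitz.
  The estimates hold for arbitrary pairs of points of a cell, so they can be iterated along orbits.
\<close>
lemma dist_F_cell:
  assumes "x \<in> cell \<rho> q" "y \<in> cell \<rho> q"
  shows "exp (min (snd x) (snd y)) * dist x y \<le> L * dist (F x) (F y)"
    and "dist (F x) (F y) \<le> L * exp (max (snd x) (snd y)) * dist x y"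
proof -
  define t where "t = snd x"
  define u where "u = snd y"
  define X where "X = fold_cell \<rho> q x"
  define Y where "Y = fold_cell \<rho> q y"
  note defs = t_def u_def X_def Y_def
  have X: "X \<in> cube \<rho>" "Y \<in> cube \<rho>" "dist (fst x) (fst y) = dist X Y"
    using assms by (simp_all add: X_def Y_def fold_cell_in_cube dist_fold_cell)
  have dF: "(dist (F x) (F y))\<^sup>2 = (exp t - exp u)\<^sup>2 + exp t * exp u * (dist (h X) (h Y))\<^sup>2"
    using assms X by (simp add: F_cell dist_reflect_pow dist_polar norm_h flip: defs)
  have dxy: "(dist x y)\<^sup>2 = (dist X Y)\<^sup>2 + (t - u)\<^sup>2"
    using X(3) by (simp add: dist_prod_def dist_real_def defs(1,2))
  have exp_prod: "exp (min t u) ^ 2 \<le> exp t * exp u" "exp t * exp u \<le> exp (max t u) ^ 2"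
    by (simp_all add: power2_eq_square min_def max_def)
  have L_sq: "A \<le> L\<^sup>2 * A" if "0 \<le> A" for A
    using mult_right_mono[of 1 "L\<^sup>2" A] that L_ge_1 by simp
  show "exp (min (snd x) (snd y)) * dist x y \<le> L * dist (F x) (F y)"
  proof (rule power2_le_imp_le)
    have a: "(exp (min t u))\<^sup>2 * (t - u)\<^sup>2 \<le> (exp t - exp u)\<^sup>2"
      using power_mono[OF exp_diff_bounds(1)[of t u], of 2] by (simp add: power_mult_distrib)
    have "(exp t - exp u)\<^sup>2 \<le> L\<^sup>2 * (exp t - exp u)\<^sup>2"
      by (rule L_sq) simp
    with a have 1: "(exp (min t u))\<^sup>2 * (t - u)\<^sup>2 \<le> L\<^sup>2 * (exp t - exp u)\<^sup>2" by linarith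
    have "(dist X Y)\<^sup>2 \<le> L\<^sup>2 * (dist (h X) (h Y))\<^sup>2"
      using power_mono[OF h_lower[OF X(1,2)], of 2] by (simp add: power_mult_distrib)
    then have 2: "(exp (min t u))\<^sup>2 * (dist X Y)\<^sup>2 \<le> (exp t * exp u) * (L\<^sup>2 * (dist (h X) (h Y))\<^sup>2)"
      using exp_prod by (intro mult_mono) auto
    show "(exp (min (snd x) (snd y)) * dist x y)\<^sup>2 \<le> (L * dist (F x) (F y))\<^sup>2"
      using 1 2 unfolding power_mult_distrib dF dxy defs(1,2)[symmetric]
      by (simp add: algebra_simps)
  qed (use L_ge_1 in auto)
  show "dist (F x) (F y) \<le> L * exp (max (snd x) (snd y)) * dist x y"
  proof (rule power2_le_imp_le)
    have a: "(exp t - exp u)\<^sup>2 \<le> (exp (max t u))\<^sup>2 * (t - u)\<^sup>2"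
      using power_mono[OF exp_diff_bounds(2)[of t u], of 2] by (simp add: power_mult_distrib)
    have "(exp (max t u))\<^sup>2 * (t - u)\<^sup>2 \<le> L\<^sup>2 * ((exp (max t u))\<^sup>2 * (t - u)\<^sup>2)"
      by (rule L_sq) simp
    with a have 1: "(exp t - exp u)\<^sup>2 \<le> L\<^sup>2 * ((exp (max t u))\<^sup>2 * (t - u)\<^sup>2)" by linarith
    have "(dist (h X) (h Y))\<^sup>2 \<le> L\<^sup>2 * (dist X Y)\<^sup>2"
      using power_mono[OF h_upper[OF X(1,2)], of 2] by (simp add: power_mult_distrib)
    then have 2: "(exp t * exp u) * (dist (h X) (h Y))\<^sup>2 \<le> (exp (max t u))\<^sup>2 * (L\<^sup>2 * (dist X Y)\<^sup>2)"
      using exp_prod by (intro mult_mono) auto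
    show "(dist (F x) (F y))\<^sup>2 \<le> (L * exp (max (snd x) (snd y)) * dist x y)\<^sup>2"
      using 1 2 unfolding power_mult_distrib dF dxy defs(1,2)[symmetric]
      by (simp add: algebra_simps)
  qed (use L_ge_1 in auto)
qed

text \<open>
  Over a cell with even indices no reflection occurs, so the inverse branch is given by
  polar coordinates and a preimage under \<open>h\<close>.
\<close>
lemma preimage_in_even_cell:
  assumes "p \<noteq> 0" "0 \<le> snd p"
  shows "\<exists>x\<in>cell \<rho> (\<lambda>j. 2 * k j). F x = p \<and> snd x = ln (norm p)"
proof -
  have "(1 / norm p) *\<^sub>R p \<in> upper_hemisphere"
    using assms by (simp add: upper_hemisphere_def)
  then obtain z where z: "z \<in> cube \<rho>" "h z = (1 / norm p) *\<^sub>R p" using h_onto by (metis imageE)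
  define x where "x = ((\<chi> j. z $ j + 2 * \<rho> * of_int (2 * k j)), ln (norm p))"
  have x: "x \<in> cell \<rho> (\<lambda>j. 2 * k j)" using z by (simp add: x_def cell_def cube_def)
  have "fold_cell \<rho> (\<lambda>j. 2 * k j) x = z"
    by (simp add: fold_cell_def x_def vec_eq_iff power_int_minus_left)
  moreover have "even (\<Sum>j\<in>UNIV. 2 * k j)" by (simp flip: sum_distrib_left)
  ultimately have "F x = p"
    using x z assms by (simp add: F_cell reflect_pow_def power_int_minus_left) (simp add: x_def)
  then show ?thesis using x by (auto simp: x_def)
qed

end

lemma zorich_locale:
  fixes h :: "real ^ 'n::finite \<Rightarrow> 'n space"
  assumes "zorich_map \<rho> h F"
  obtains L where "zorich \<rho> h F L"
proof -
  obtain K where K: "K > 0" "\<forall>x\<in>cube \<rho>. \<forall>y\<in>cube \<rho>. dist x y / K \<le> dist (h x) (h y) \<and>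
      dist (h x) (h y) \<le> K * dist x y"
    using assms unfolding zorich_map_def bi_lipschitz_on_def by blast
  have "zorich \<rho> h F (max 1 K)"
  proof
    fix x y :: "real ^ 'n" assume xy: "x \<in> cube \<rho>" "y \<in> cube \<rho>"
    have *: "K * d \<le> max 1 K * d" if "0 \<le> d" for d :: real
      using that by (intro mult_right_mono) auto
    show "dist x y \<le> max 1 K * dist (h x) (h y)"
      using K(1) K(2)[rule_format, OF xy] *[of "dist (h x) (h y)"]
      by (simp add: divide_le_eq mult.commute)
    show "dist (h x) (h y) \<le> max 1 K * dist x y"
      using K(2)[rule_format, OF xy] *[of "dist x y"] by simp
  qed (use assms in auto)
  then show ?thesis by (rule that)
qed

section \<open>The basin of attraction\<close>

context zorich
begin

abbreviation f :: "real \<Rightarrow> 'n space \<Rightarrow> 'n space" where "f \<equiv> shifted F"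

lemma dist_f: "dist (f a x) (f a y) = dist (F x) (F y)"
  by (simp add: shifted_def dist_norm)

lemma dist_f_center: "dist (f a x) (0, - a) = exp (snd x)"
proof -
  have "f a x - (0, - a) = F x" by (simp add: shifted_def)
  then show ?thesis by (simp add: dist_norm norm_F)
qed

lemma snd_f: "snd (f a x) = snd (F x) - a"
  by (simp add: shifted_def)

lemma snd_le_exp: "\<bar>snd (F x)\<bar> \<le> exp (snd x)"
  using norm_snd_le[of "snd (F x)" "fst (F x)"] by (simp add: norm_F)

lemma cball_center:
  assumes "x \<in> cball (0, - a) \<rho>"
  shows "x \<in> cell \<rho> (\<lambda>_. 0)" "snd x \<le> \<rho> - a"
proof -
  have *: "norm (fst x, snd x + a) \<le> \<rho>"
  proof -
    have "x - (0, - a) = (fst x, snd x + a)" by (simp add: prod_eq_iff)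
    then show ?thesis using assms by (simp add: dist_norm norm_minus_commute[of "(0, - a)" x])
  qed
  have "norm (fst x) \<le> \<rho>" using norm_fst_le[of "fst x" "snd x + a"] * by linarith
  then show "x \<in> cell \<rho> (\<lambda>_. 0)"
    by (auto simp: cell_def intro: order_trans[OF component_le_norm_cart])
  show "snd x \<le> \<rho> - a" using norm_snd_le[of "snd x + a" "fst x"] * by auto
qed

text \<open>
  Two steps map the half-space into the ball of radius \<open>\<rho>\<close> about \<open>(0, - a)\<close>: the first
  one makes the last coordinate very negative, the second one makes \<open>F\<close> tiny. That ball lies in
  the central cell, where \<open>dist_F_cell\<close> makes \<open>f a\<close> a contraction. Hence Lipschitz estimates across the
  boundaries of cells are avoided.
\<close>
lemma halfspace_in_basin:
  assumes a: "L * exp (\<rho> - a) \<le> 1 / 2" "exp (\<rho> - a) \<le> \<rho>" "exp (exp m - a) \<le> \<rho>"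
      "\<rho> - a \<le> m" "\<rho> < a"
  defines "\<xi> \<equiv> attracting_fixpoint (f a) m"
  shows "snd \<xi> < 0" "snd x \<le> m \<Longrightarrow> (\<lambda>n. (f a ^^ n) x) \<longlonglongrightarrow> \<xi>"
proof -
  define D :: "'n space set" where "D = cball (0, - a) \<rho>"
  have D: "x \<in> cell \<rho> (\<lambda>_. 0)" "snd x \<le> \<rho> - a" if "x \<in> D" for x
    using cball_center that unfolding D_def by blast+
  have f_D: "f a x \<in> D" if "exp (snd x) \<le> \<rho>" for x
    using that dist_f_center[of a x] by (simp add: D_def dist_commute)
  have D_D: "f a x \<in> D" if "x \<in> D" for x
  proof (rule f_D)
    have "exp (snd x) \<le> exp (\<rho> - a)" using D(2)[OF that] by simp
    then show "exp (snd x) \<le> \<rho>" using a(2) by linarith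
  qed
  have contract: "dist (f a x) (f a y) \<le> 1 / 2 * dist x y" if "x \<in> D" "y \<in> D" for x y
  proof -
    have "dist (f a x) (f a y) \<le> L * exp (max (snd x) (snd y)) * dist x y"
      unfolding dist_f by (rule dist_F_cell(2)[OF D(1)[OF that(1)] D(1)[OF that(2)]])
    also have "L * exp (max (snd x) (snd y)) \<le> L * exp (\<rho> - a)"
      using L_ge_1 D(2)[OF that(1)] D(2)[OF that(2)] by (intro mult_left_mono) auto
    then have "L * exp (max (snd x) (snd y)) * dist x y \<le> 1 / 2 * dist x y"
      using a(1) by (intro mult_right_mono) auto
    finally show ?thesis .
  qed
  have H_D: "f a (f a x) \<in> D" if "snd x \<le> m" for x
  proof (rule f_D)
    have "snd (f a x) \<le> exp m - a"
      using snd_le_exp[of x] that by (simp add: snd_f) (smt (verit) exp_le_cancel_iff)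
    then have "exp (snd (f a x)) \<le> exp (exp m - a)" by simp
    then show "exp (snd (f a x)) \<le> \<rho>" using a(3) by linarith
  qed
  have "\<exists>!x\<in>D. f a x = x"
  proof (rule Banach_fix[OF compact_imp_complete, where c = "1 / 2"])
    show "compact D" by (simp add: D_def)
    show "D \<noteq> {}" using \<rho>_pos by (simp add: D_def)
  qed (use contract D_D in auto)
  then obtain z where z: "z \<in> D" "f a z = z" "\<And>w. w \<in> D \<Longrightarrow> f a w = w \<Longrightarrow> w = z" by blast
  have "\<xi> = z"
    unfolding \<xi>_def attracting_fixpoint_def
  proof (rule the_equality)
    show "snd z \<le> m \<and> f a z = z" using z(1,2) D(2)[of z] a(4) by auto
    fix w assume w: "snd w \<le> m \<and> f a w = w"
    then have "w \<in> D" using H_D[of w] by simp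
    then show "w = z" using w by (intro z(3)) auto
  qed
  then show "snd \<xi> < 0" using D(2)[OF z(1)] a(5) by simp
  assume "snd x \<le> m"
  define y where "y = (f a ^^ 2) x"
  have y: "y \<in> D" using H_D[OF \<open>snd x \<le> m\<close>] by (simp add: y_def numeral_2_eq_2)
  have *: "(f a ^^ n) y \<in> D \<and> dist ((f a ^^ n) y) z \<le> (1 / 2) ^ n * dist y z" for n
  proof (induction n)
    case (Suc n)
    have "dist (f a ((f a ^^ n) y)) (f a z) \<le> 1 / 2 * dist ((f a ^^ n) y) z"
      using Suc z(1) by (intro contract) auto
    also have "\<dots> \<le> 1 / 2 * ((1 / 2) ^ n * dist y z)" using Suc by simp
    finally show ?case using Suc D_D z(2) by simp
  qed (use y in auto)
  have "(\<lambda>n. (1 / 2) ^ n * dist y z) \<longlonglongrightarrow> 0 * dist y z"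
    by (intro tendsto_mult tendsto_const LIMSEQ_power_zero) auto
  then have "(\<lambda>n. dist ((f a ^^ n) y) z) \<longlonglongrightarrow> 0"
    by (intro tendsto_sandwich[of "\<lambda>_. 0" "\<lambda>n. dist ((f a ^^ n) y) z" _
          "\<lambda>n. (1 / 2) ^ n * dist y z"]) (use * in auto)
  then have "(\<lambda>n. (f a ^^ n) y) \<longlonglongrightarrow> z" by (simp add: tendsto_dist_iff[symmetric])
  then have "(\<lambda>n. (f a ^^ (n + 2)) x) \<longlonglongrightarrow> z" by (simp only: y_def funpow_add o_apply)
  then show "(\<lambda>n. (f a ^^ n) x) \<longlonglongrightarrow> \<xi>"
    unfolding \<open>\<xi> = z\<close> by (rule LIMSEQ_offset)
qed

section \<open>The upper bound\<close>

text \<open>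
  The points whose orbits avoid the half-space that belongs to the basin of attraction.
\<close>
definition survivors :: "real \<Rightarrow> real \<Rightarrow> 'n space set" where
  "survivors a m = {x. \<forall>n. m < snd ((f a ^^ n) x)}"

lemma f_survivors:
  assumes "x \<in> survivors a m"
  shows "f a x \<in> survivors a m"
proof -
  have "m < snd ((f a ^^ Suc n) x)" for n using assms unfolding survivors_def by blast
  then show ?thesis by (simp add: survivors_def funpow_Suc_right del: funpow.simps)
qed

text \<open>
  If the last coordinate of \<open>x\<close> were negative, then \<open>F x\<close> would have norm less than 1 and
  \<open>f a x\<close> would lie in the half-space to be avoided.
\<close>
lemma survivors_snd_nonneg:
  assumes "x \<in> survivors a m" "1 \<le> a + m"
  shows "0 \<le> snd x"
proof -
  have "m < snd ((f a ^^ 1) x)" using assms unfolding survivors_def by blast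
  then have "1 \<le> exp (snd x)" using snd_le_exp[of x] assms(2) by (simp add: snd_f del: one_le_exp_iff)
  then show ?thesis by simp
qed

end

definition sup_norm :: "('n::finite \<Rightarrow> int) \<Rightarrow> real" where
  "sup_norm q = of_int (Max (range (\<lambda>j. \<bar>q j\<bar>)))"

lemma sup_norm_le_iff: "sup_norm q \<le> c \<longleftrightarrow> (\<forall>j. \<bar>of_int (q j)\<bar> \<le> c)" for q :: "'n::finite \<Rightarrow> int"
proof -
  have "sup_norm q \<le> c \<longleftrightarrow> Max (range (\<lambda>j. \<bar>q j\<bar>)) \<le> \<lfloor>c\<rfloor>" by (simp add: sup_norm_def le_floor_iff)
  also have "\<dots> \<longleftrightarrow> (\<forall>j. \<bar>q j\<bar> \<le> \<lfloor>c\<rfloor>)" by (subst Max_le_iff) auto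
  finally show ?thesis by (simp add: le_floor_iff)
qed

context zorich
begin

text \<open>
  The point \<open>F x = f a x + (0, a)\<close> has norm \<open>exp (snd x)\<close>. Its last coordinate is at
  least \<open>a\<close>, as \<open>f a x\<close> survives too, and its other coordinates are comparable to those of
  \<open>q\<close>.
\<close>
lemma survivors_exp_ge:
  assumes "x \<in> survivors a m" "1 \<le> a + m" "f a x \<in> cell \<rho> q" "0 \<le> a"
  shows "min 1 \<rho> * max a (sup_norm q) \<le> exp (snd x)"
proof -
  have "0 \<le> snd (f a x)" using assms f_survivors survivors_snd_nonneg by blast
  then have "a \<le> exp (snd x)" using snd_le_exp[of x] by (simp add: snd_f)
  then have "min 1 \<rho> * a \<le> exp (snd x)"
    using mult_right_mono[of "min 1 \<rho>" 1 a] \<open>0 \<le> a\<close> by linarith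
  moreover have "sup_norm q \<le> exp (snd x) / min 1 \<rho>"
    unfolding sup_norm_le_iff
  proof
    fix j
    have "\<bar>fst (F x) $ j\<bar> \<le> exp (snd x)"
      using component_le_norm_cart[of "fst (F x)" j] norm_fst_le[of "fst (F x)" "snd (F x)"]
      by (simp add: norm_F)
    moreover have "\<bar>fst (F x) $ j - 2 * \<rho> * of_int (q j)\<bar> \<le> \<rho>"
      using assms(3) by (simp add: cell_def shifted_def)
    ultimately have 1: "\<bar>2 * \<rho> * of_int (q j)\<bar> \<le> exp (snd x) + \<rho>" by linarith
    have 2: "\<bar>2 * \<rho> * of_int (q j)\<bar> = 2 * (\<rho> * \<bar>of_int (q j)\<bar>)"
      using \<rho>_pos by (simp add: abs_mult)
    have "\<rho> * \<bar>of_int (q j)\<bar> \<le> exp (snd x)"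
    proof (cases "q j = 0")
      case False
      then have "1 \<le> \<bar>q j\<bar>" by simp
      then have "1 \<le> \<bar>real_of_int (q j)\<bar>" by linarith
      then have "\<rho> * 1 \<le> \<rho> * \<bar>of_int (q j)\<bar>" using \<rho>_pos by (intro mult_left_mono) auto
      then show ?thesis using 1 2 by linarith
    qed simp
    moreover have "min 1 \<rho> * \<bar>of_int (q j)\<bar> \<le> \<rho> * \<bar>of_int (q j)\<bar>" by (intro mult_right_mono) auto
    ultimately show "\<bar>of_int (q j)\<bar> \<le> exp (snd x) / min 1 \<rho>"
      using \<rho>_pos by (simp add: pos_le_divide_eq mult.commute)
  qed
  then have "min 1 \<rho> * sup_norm q \<le> exp (snd x)"
    using \<rho>_pos by (simp add: pos_le_divide_eq mult.commute)
  ultimately show ?thesis by (simp add: max_def)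
qed

text \<open>
  A bound for the contraction factor of the inverse branches at points of the cell \<open>q\<close>.
\<close>
definition rate :: "real \<Rightarrow> ('n \<Rightarrow> int) \<Rightarrow> real" where
  "rate a q = L / (min 1 \<rho> * max a (sup_norm q))"

lemma survivors_expand:
  assumes "x \<in> survivors a m" "y \<in> survivors a m" "1 \<le> a + m" "0 < a"
    and "x \<in> cell \<rho> p" "y \<in> cell \<rho> p" "f a x \<in> cell \<rho> q" "f a y \<in> cell \<rho> q"
  shows "dist x y \<le> rate a q * dist (f a x) (f a y)"
proof -
  let ?w = "min 1 \<rho> * max a (sup_norm q)"
  have "0 < ?w" using \<rho>_pos assms(4) by simp
  have "?w \<le> exp (min (snd x) (snd y))"
    using survivors_exp_ge[of x] survivors_exp_ge[of y] assms by (simp add: min_def)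
  then have "?w * dist x y \<le> exp (min (snd x) (snd y)) * dist x y"
    by (rule mult_right_mono) simp
  also have "\<dots> \<le> L * dist (f a x) (f a y)"
    using assms unfolding dist_f by (intro dist_F_cell)
  finally show ?thesis using \<open>0 < ?w\<close> by (simp add: rate_def pos_le_divide_eq mult.commute)
qed

text \<open>
  Induction over the time of the return: the points that start in the cell \<open>q\<close> are split by the
  cell \<open>q'\<close> of their image, each part is a preimage with contraction factor \<open>rate a q'\<close>, and
  summing over \<open>q'\<close> costs the factor \<open>t\<close>. Since the bound is uniform in \<open>q\<close>, there is
  no need to sum over whole words of letters.
\<close>
lemma covered_returning:
  assumes a: "1 \<le> a + m" "0 < a" and "0 < s" "0 \<le> R"
    and sum: "(\<integral>\<^sup>+ q. ennreal (rate a q powr s) \<partial>count_space UNIV) \<le> ennreal t" and "0 \<le> t"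
  shows "covered s {x \<in> survivors a m \<inter> cell \<rho> q. norm ((f a ^^ n) x) \<le> R}
           (ennreal (t ^ n * (2 * R) powr s))"
proof (induction n arbitrary: q)
  case 0
  let ?A = "{x \<in> survivors a m \<inter> cell \<rho> q. norm ((f a ^^ 0) x) \<le> R}"
  have "bounded ?A" by (rule boundedI[of _ R]) auto
  moreover have "diameter ?A \<le> 2 * R"
    using \<open>0 \<le> R\<close> by (intro diameter_leI) (auto intro: order_trans[OF norm_triangle_ineq4] simp: dist_norm)
  ultimately show ?case using covered_bounded[of ?A "2 * R" s] \<open>0 < s\<close> by simp
next
  case (Suc n)
  let ?A = "\<lambda>n q. {x \<in> survivors a m \<inter> cell \<rho> q. norm ((f a ^^ n) x) \<le> R}"
  let ?c = "ennreal (t ^ n * (2 * R) powr s)"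
  define B where "B q' = {x \<in> ?A (Suc n) q. f a x \<in> cell \<rho> q'}" for q'
  have "covered s (B q') (ennreal (rate a q' powr s) * ?c)" for q'
  proof (rule covered_expanding_preimage)
    have "f a ` B q' \<subseteq> ?A n q'"
      by (auto simp: B_def f_survivors funpow_swap1)
    then show "covered s (f a ` B q') ?c" using Suc.IH covered_mono by blast
    show "dist x y \<le> rate a q' * dist (f a x) (f a y)" if "x \<in> B q'" "y \<in> B q'" for x y
      using that a survivors_expand[of x a m y q q'] by (auto simp: B_def)
    show "0 \<le> rate a q'" using L_ge_1 \<rho>_pos a(2) by (simp add: rate_def)
  qed (use \<open>0 < s\<close> in simp)
  then have cov: "covered s (\<Union>q'. B q') (\<integral>\<^sup>+ q'. ennreal (rate a q' powr s) * ?c \<partial>count_space UNIV)"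
    by (rule covered_UN)
  have sub: "?A (Suc n) q \<subseteq> (\<Union>q'. B q')"
  proof
    fix x assume "x \<in> ?A (Suc n) q"
    moreover obtain q' where "f a x \<in> cell \<rho> q'" using in_some_cell by blast
    ultimately show "x \<in> (\<Union>q'. B q')" unfolding B_def by blast
  qed
  have le: "(\<integral>\<^sup>+ q'. ennreal (rate a q' powr s) * ?c \<partial>count_space UNIV) \<le> ennreal t * ?c"
    using sum by (simp add: nn_integral_multc mult_right_mono)
  have eq: "ennreal t * ?c = ennreal (t ^ Suc n * (2 * R) powr s)"
    using \<open>0 \<le> t\<close> by (simp add: mult.assoc flip: ennreal_mult)
  show ?case unfolding eq[symmetric] by (rule covered_mono[OF cov sub le])
qed

text \<open>
  Infinitely many returns mean a return after any given time, so the geometric tails of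
  \<open>covered_returning\<close> cover the set.
\<close>
lemma null_recurrent:
  assumes a: "1 \<le> a + m" "0 < a" and "0 < s" "0 \<le> R"
    and sum: "(\<integral>\<^sup>+ q. ennreal (rate a q powr s) \<partial>count_space UNIV) \<le> ennreal t"
    and t: "0 \<le> t" "t < 1" and "0 < \<epsilon>"
  shows "covered s {x \<in> survivors a m \<inter> cell \<rho> q. \<exists>\<^sub>F n in sequentially. norm ((f a ^^ n) x) \<le> R}
           (ennreal \<epsilon>)"
proof -
  define c where "c = (2 * R) powr s"
  have "(\<lambda>n. t ^ n * (c / (1 - t))) \<longlonglongrightarrow> 0 * (c / (1 - t))"
    using t by (intro tendsto_mult tendsto_const LIMSEQ_power_zero) auto
  then have "\<forall>\<^sub>F n in sequentially. t ^ n * (c / (1 - t)) < \<epsilon>"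
    using \<open>0 < \<epsilon>\<close> by (intro order_tendstoD) auto
  then obtain k where k: "t ^ k * (c / (1 - t)) < \<epsilon>" by (auto simp: eventually_sequentially)
  let ?A = "\<lambda>n. {x \<in> survivors a m \<inter> cell \<rho> q. norm ((f a ^^ n) x) \<le> R}"
  have "covered s (\<Union>n. ?A (n + k)) (\<Sum>n. ennreal (t ^ (n + k) * c))"
    unfolding c_def using assms by (intro covered_UN_nat covered_returning)
  moreover have "{x \<in> survivors a m \<inter> cell \<rho> q. \<exists>\<^sub>F n in sequentially. norm ((f a ^^ n) x) \<le> R}
      \<subseteq> (\<Union>n. ?A (n + k))"
  proof safe
    fix y z assume *: "(y, z) \<in> survivors a m" "(y, z) \<in> cell \<rho> q"
      "\<exists>\<^sub>F n in sequentially. norm ((f a ^^ n) (y, z)) \<le> R"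
    then obtain n where "n \<ge> k" "norm ((f a ^^ n) (y, z)) \<le> R"
      unfolding frequently_sequentially by blast
    then show "(y, z) \<in> (\<Union>n. ?A (n + k))"
      using * by (auto intro!: exI[of _ "n - k"])
  qed
  moreover have "(\<Sum>n. ennreal (t ^ (n + k) * c)) \<le> ennreal \<epsilon>"
  proof -
    have "(\<lambda>n. t ^ n * (t ^ k * c)) sums (1 / (1 - t) * (t ^ k * c))"
      using t by (intro sums_mult2 geometric_sums) auto
    then have "(\<lambda>n. t ^ (n + k) * c) sums (t ^ k * (c / (1 - t)))"
      by (simp add: power_add mult_ac)
    then have "(\<Sum>n. ennreal (t ^ (n + k) * c)) = ennreal (t ^ k * (c / (1 - t)))"
      using t by (intro suminf_ennreal_eq) (auto simp: c_def)
    then show ?thesis using k by (simp add: ennreal_leI)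
  qed
  ultimately show ?thesis using covered_mono by blast
qed

lemma dim_J_r_le:
  assumes a: "1 \<le> a + m" "0 < a" and "0 < s"
    and sum: "(\<integral>\<^sup>+ q. ennreal (rate a q powr s) \<partial>count_space UNIV) \<le> ennreal t"
    and t: "0 \<le> t" "t < 1"
    and basin: "\<And>x. snd x \<le> m \<Longrightarrow> (\<lambda>n. (f a ^^ n) x) \<longlonglongrightarrow> \<xi>"
  shows "hausdorff_dim (J_r (f a) \<xi>) \<le> ereal s"
proof (rule hausdorff_dim_le[OF \<open>0 < s\<close>])
  fix \<epsilon> :: real assume "0 < \<epsilon>"
  define E where "E i = {x \<in> survivors a m \<inter> cell \<rho> (snd i).
      \<exists>\<^sub>F n in sequentially. norm ((f a ^^ n) x) \<le> real (fst i)}" for i :: "nat \<times> ('n \<Rightarrow> int)"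
  have "covered s (E i) (ennreal \<epsilon>)" if "0 < \<epsilon>" for i \<epsilon>
    unfolding E_def by (rule null_recurrent[OF a \<open>0 < s\<close> _ sum t that]) simp
  then have "covered s (\<Union>i. E i) (ennreal \<epsilon>)" using \<open>0 < \<epsilon>\<close> by (rule null_UN)
  moreover have "J_r (f a) \<xi> \<subseteq> (\<Union>i. E i)"
  proof
    fix x assume x: "x \<in> J_r (f a) \<xi>"
    have "m < snd ((f a ^^ n) x)" for n
    proof (rule ccontr)
      assume "\<not> m < snd ((f a ^^ n) x)"
      then have "(\<lambda>k. (f a ^^ k) ((f a ^^ n) x)) \<longlonglongrightarrow> \<xi>" by (intro basin) simp
      then have "(\<lambda>k. (f a ^^ (k + n)) x) \<longlonglongrightarrow> \<xi>" by (simp add: funpow_add)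
      then have "(\<lambda>k. (f a ^^ k) x) \<longlonglongrightarrow> \<xi>" by (rule LIMSEQ_offset)
      then show False using x by (simp add: J_r_def)
    qed
    then have "x \<in> survivors a m" by (simp add: survivors_def)
    moreover obtain q where "x \<in> cell \<rho> q" using in_some_cell by blast
    moreover have "\<exists>N::nat. \<exists>\<^sub>F n in sequentially. norm ((f a ^^ n) x) \<le> real N"
    proof -
      have "\<not> filterlim (\<lambda>n. norm ((f a ^^ n) x)) at_top sequentially"
        using x by (simp add: J_r_def)
      then obtain Z where Z: "\<exists>\<^sub>F n in sequentially. \<not> Z \<le> norm ((f a ^^ n) x)"
        unfolding filterlim_at_top not_eventually[symmetric] by blast
      obtain N :: nat where "Z \<le> real N" using real_arch_simple by blast
      then show ?thesis
        by (intro exI[of _ N] frequently_elim1[OF Z]) linarith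
    qed
    ultimately show "x \<in> (\<Union>i. E i)" by (auto simp: E_def)
  qed
  ultimately show "covered s (J_r (f a) \<xi>) (ennreal \<epsilon>)" using covered_mono by blast
qed

end

section \<open>Lattice sums\<close>

text \<open>
  Dyadic decomposition: about $(2^k a)^N$ lattice points contribute $(2^k a)^{-N-\epsilon}$ each, which
  leaves a geometric series with ratio $2^{-\epsilon}$, and $1 - 2^{-\epsilon}$ is at least
  $\epsilon / 4$. The factor $2^{N+1}$ comes from replacing the size of a lattice point by the upper
  end of its dyadic range.
\<close>
lemma nn_integral_lattice_le:
  fixes a \<epsilon> :: real
  defines "N \<equiv> CARD('n::finite)"
  assumes "1 \<le> a" "0 < \<epsilon>" "\<epsilon> \<le> 1"
  shows "(\<integral>\<^sup>+ q. ennreal (max a (sup_norm (q :: 'n \<Rightarrow> int)) powr - (real N + \<epsilon>)) \<partial>count_space UNIV)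
    \<le> ennreal (3 ^ N * 2 ^ (N + 1) * 4 * (a powr - \<epsilon> / \<epsilon>))"
proof -
  define s where "s = real N + \<epsilon>"
  have "0 < s" using \<open>0 < \<epsilon>\<close> by (simp add: s_def)
  define b where "b k = 2 ^ k * a" for k :: nat
  have b: "1 \<le> b k" for k
    using mult_mono[of 1 "2 ^ k" 1 a] \<open>1 \<le> a\<close> by (simp add: b_def)
  define Q where "Q k = {q :: 'n \<Rightarrow> int. sup_norm q \<le> b k}" for k
  have Q_eq: "Q k = (\<Pi>\<^sub>E j\<in>UNIV. {- \<lfloor>b k\<rfloor>..\<lfloor>b k\<rfloor>})" for k
  proof -
    have "\<bar>real_of_int z\<bar> \<le> b k \<longleftrightarrow> - \<lfloor>b k\<rfloor> \<le> z \<and> z \<le> \<lfloor>b k\<rfloor>" for z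
    proof -
      have "\<bar>real_of_int z\<bar> \<le> b k \<longleftrightarrow> \<bar>z\<bar> \<le> \<lfloor>b k\<rfloor>" by (simp add: le_floor_iff)
      then show ?thesis by auto
    qed
    then show ?thesis by (simp add: Q_def sup_norm_le_iff set_eq_iff PiE_iff)
  qed
  have finite_Q: "finite (Q k)" for k unfolding Q_eq by (intro finite_PiE) auto
  have card_Q: "real (card (Q k)) \<le> (3 * b k) ^ N" for k
  proof -
    have "card (Q k) = nat (2 * \<lfloor>b k\<rfloor> + 1) ^ N"
      unfolding Q_eq by (simp add: card_PiE N_def algebra_simps)
    moreover have "0 \<le> \<lfloor>b k\<rfloor>" using b[of k] by simp
    ultimately have "real (card (Q k)) = (2 * of_int \<lfloor>b k\<rfloor> + 1) ^ N" by simp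
    also have "\<dots> \<le> (3 * b k) ^ N"
      using b[of k] \<open>0 \<le> \<lfloor>b k\<rfloor>\<close> by (intro power_mono) (linarith, simp)
    finally show ?thesis .
  qed
  have pointwise: "ennreal (max a (sup_norm q) powr - s)
      \<le> (\<Sum>k. ennreal ((b k / 2) powr - s) * indicator (Q k) q)" for q :: "'n \<Rightarrow> int"
  proof -
    obtain k0 where "sup_norm q / a < 2 ^ k0" using real_arch_pow[of 2 "sup_norm q / a"] by auto
    then have "q \<in> Q k0" using \<open>1 \<le> a\<close> by (simp add: Q_def b_def pos_divide_less_eq)
    define k where "k = (LEAST k. q \<in> Q k)"
    have "q \<in> Q k" unfolding k_def using \<open>q \<in> Q k0\<close> by (rule LeastI)
    have "b k / 2 \<le> max a (sup_norm q)"
    proof (cases k)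
      case 0
      then show ?thesis using \<open>1 \<le> a\<close> by (simp add: b_def)
    next
      case (Suc l)
      then have "q \<notin> Q l" using not_less_Least[of l "\<lambda>k. q \<in> Q k"] by (simp add: k_def)
      then show ?thesis by (simp add: Q_def b_def Suc)
    qed
    then have "max a (sup_norm q) powr - s \<le> (b k / 2) powr - s"
      using \<open>0 < s\<close> b[of k] by (intro powr_mono2') auto
    then have "ennreal (max a (sup_norm q) powr - s)
        \<le> (\<Sum>k\<in>{k}. ennreal ((b k / 2) powr - s) * indicator (Q k) q)"
      using \<open>q \<in> Q k\<close> by (simp add: ennreal_leI)
    also have "\<dots> \<le> (\<Sum>k. ennreal ((b k / 2) powr - s) * indicator (Q k) q)"
      by (rule sum_le_suminf) auto
    finally show ?thesis .
  qed
  define r where "r = 2 powr - \<epsilon>"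
  have r: "0 \<le> r" "r < 1" "\<epsilon> / 4 \<le> 1 - r"
  proof -
    have "\<epsilon> / 2 \<le> \<epsilon> * ln 2"
      using ln_le_minus_one[of "1 / 2 :: real"] \<open>0 < \<epsilon>\<close> by (simp add: ln_div)
    moreover have "1 + \<epsilon> * ln 2 \<le> exp (\<epsilon> * ln 2)" by (rule exp_ge_add_one_self)
    moreover have "2 powr \<epsilon> = exp (\<epsilon> * ln 2)" by (simp add: powr_def)
    ultimately have "1 + \<epsilon> / 2 \<le> 2 powr \<epsilon>" by linarith
    then have "inverse (2 powr \<epsilon>) \<le> inverse (1 + \<epsilon> / 2)"
      using \<open>0 < \<epsilon>\<close> by (intro le_imp_inverse_le) auto
    then have "r \<le> inverse (1 + \<epsilon> / 2)" by (simp add: r_def powr_minus)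
    also have "\<dots> \<le> 1 - \<epsilon> / 4"
    proof -
      have "\<epsilon> * \<epsilon> \<le> 1 * \<epsilon>" using \<open>0 < \<epsilon>\<close> \<open>\<epsilon> \<le> 1\<close> by (intro mult_right_mono) auto
      then show ?thesis using \<open>0 < \<epsilon>\<close> by (simp add: field_simps)
    qed
    finally show "\<epsilon> / 4 \<le> 1 - r" by simp
    then show "r < 1" using \<open>0 < \<epsilon>\<close> by simp
    show "0 \<le> r" by (simp add: r_def)
  qed
  define c where "c = 2 powr s * 3 ^ N * a powr - \<epsilon>"
  have ring_term: "(b k / 2) powr - s * (3 * b k) ^ N = c * r ^ k" for k
  proof -
    have bk: "0 < b k" using b[of k] by simp
    have "b k powr - \<epsilon> = r ^ k * a powr - \<epsilon>"
      unfolding b_def powr_mult r_def by (simp add: powr_powr powr_realpow[symmetric] mult.commute)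
    moreover have "b k powr - s * b k ^ N = b k powr - \<epsilon>"
      using bk by (simp add: s_def powr_realpow[symmetric] powr_add[symmetric])
    moreover have "(b k / 2) powr - s = b k powr - s * 2 powr s"
      using bk by (simp add: powr_divide powr_minus_divide)
    ultimately show ?thesis by (simp add: c_def power_mult_distrib mult_ac)
  qed
  have "(\<integral>\<^sup>+ q. ennreal (max a (sup_norm (q :: 'n \<Rightarrow> int)) powr - s) \<partial>count_space UNIV)
      \<le> (\<integral>\<^sup>+ q. (\<Sum>k. ennreal ((b k / 2) powr - s) * indicator (Q k) q) \<partial>count_space UNIV)"
    by (intro nn_integral_mono pointwise)
  also have "\<dots> = (\<Sum>k. \<integral>\<^sup>+ q. ennreal ((b k / 2) powr - s) * indicator (Q k) q \<partial>count_space UNIV)"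
    by (rule nn_integral_suminf) simp
  also have "\<dots> = (\<Sum>k. ennreal ((b k / 2) powr - s) * ennreal (real (card (Q k))))"
    using finite_Q by (simp add: nn_integral_cmult_indicator ennreal_of_nat_eq_real_of_nat)
  also have "\<dots> \<le> (\<Sum>k. ennreal (c * r ^ k))"
    unfolding ring_term[symmetric] using card_Q
    by (intro suminf_le) (auto simp: ennreal_mult[symmetric] intro!: ennreal_leI mult_left_mono)
  also have "\<dots> = ennreal (c * (1 / (1 - r)))"
    using r by (intro suminf_ennreal_eq sums_mult geometric_sums) (auto simp: c_def)
  also have "\<dots> \<le> ennreal (3 ^ N * 2 ^ (N + 1) * 4 * (a powr - \<epsilon> / \<epsilon>))"
  proof (rule ennreal_leI)
    have "2 powr s \<le> 2 powr real (N + 1)" using \<open>\<epsilon> \<le> 1\<close> by (intro powr_mono) (auto simp: s_def)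
    also have "\<dots> = 2 ^ (N + 1)" by (rule powr_realpow) simp
    finally have "c \<le> 2 ^ (N + 1) * 3 ^ N * a powr - \<epsilon>"
      unfolding c_def by (intro mult_right_mono) auto
    moreover have "1 / (1 - r) \<le> 1 / (\<epsilon> / 4)"
      using r \<open>0 < \<epsilon>\<close> by (intro divide_left_mono) auto
    ultimately have "c * (1 / (1 - r)) \<le> (2 ^ (N + 1) * 3 ^ N * a powr - \<epsilon>) * (1 / (\<epsilon> / 4))"
      using r by (intro mult_mono) auto
    then show "c * (1 / (1 - r)) \<le> 3 ^ N * 2 ^ (N + 1) * 4 * (a powr - \<epsilon> / \<epsilon>)"
      by (simp add: mult_ac)
  qed
  finally show ?thesis unfolding s_def .
qed

text \<open>
  A positive proportion of the lattice points of sup-norm \<open>n\<close>. It is a product set, which makes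
  counting immediate, and its members have their norm as their \<open>i\<close>-th coordinate.
\<close>
definition corner_shell :: "'n \<Rightarrow> nat \<Rightarrow> ('n::finite \<Rightarrow> int) set" where
  "corner_shell i n = {k. k i = int n \<and> (\<forall>j. 0 \<le> k j \<and> k j \<le> int n)}"

lemma card_corner_shell: "card (corner_shell i n :: ('n::finite \<Rightarrow> int) set) = (n + 1) ^ (CARD('n) - 1)"
  and finite_corner_shell: "finite (corner_shell i n :: ('n \<Rightarrow> int) set)"
proof -
  let ?T = "\<lambda>j. if j = i then {int n} else {0..int n}"
  have eq: "corner_shell i n = (\<Pi>\<^sub>E j\<in>UNIV. ?T j)"
    by (auto simp: corner_shell_def PiE_iff split: if_splits) (metis of_nat_0_le_iff order_refl)+
  show "finite (corner_shell i n :: ('n \<Rightarrow> int) set)" unfolding eq by (intro finite_PiE) auto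
  have "card (corner_shell i n :: ('n \<Rightarrow> int) set) = (\<Prod>j\<in>UNIV. card (?T j))"
    unfolding eq by (rule card_PiE) simp
  also have "\<dots> = card (?T i) * (\<Prod>j\<in>UNIV - {i}. card (?T j))"
    by (rule prod.remove) auto
  also have "(\<Prod>j\<in>UNIV - {i}. card (?T j)) = (\<Prod>j\<in>UNIV - {i}. n + 1)"
    by (rule prod.cong) auto
  finally show "card (corner_shell i n :: ('n \<Rightarrow> int) set) = (n + 1) ^ (CARD('n) - 1)"
    by (simp add: card_Diff_singleton)
qed

lemma harmonic_ge_ln:
  assumes "0 < m" "m \<le> n"
  shows "ln (real (n + 1) / real m) \<le> (\<Sum>i=m..n. 1 / real i)"
  using assms(2)
proof (induction n rule: dec_induct)
  case base
  have "ln (1 + 1 / real m) \<le> 1 / real m" by (rule ln_add_one_self_le_self) simp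
  then show ?case using \<open>0 < m\<close> by (simp add: field_simps)
next
  case (step n)
  have "ln (real (Suc n + 1) / real m) = ln (real (n + 1) / real m) + ln (1 + 1 / real (Suc n))"
  proof -
    have "real (Suc n + 1) / real m = real (n + 1) / real m * (1 + 1 / real (Suc n))"
      by (simp add: divide_simps)
    moreover have "0 < real (n + 1) / real m" "0 < 1 + 1 / real (Suc n)"
      using \<open>0 < m\<close> by (simp_all add: add_pos_pos)
    ultimately show ?thesis by (simp only: ln_mult_pos)
  qed
  also have "ln (1 + 1 / real (Suc n)) \<le> 1 / real (Suc n)" by (rule ln_add_one_self_le_self) simp
  finally show ?case using step by simp
qed

text \<open>
  The shell of radius \<open>n\<close> has at least $n^{N-1}$ points and contributes $1/n$ up to the factor
  $n^{-\epsilon} \ge B^{-\epsilon}$, so the harmonic sum produces the logarithm.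
\<close>
lemma corner_shell_sum_ge:
  fixes i :: "'n::finite" and C \<epsilon> B :: real and n\<^sub>0 n\<^sub>1 :: nat
  defines "N \<equiv> CARD('n)"
  assumes "1 \<le> C" "0 < \<epsilon>" "\<epsilon> \<le> 1" "0 < n\<^sub>0" "n\<^sub>0 \<le> n\<^sub>1" "real n\<^sub>1 \<le> B"
  shows "B powr - \<epsilon> * ln (real (n\<^sub>1 + 1) / real n\<^sub>0) / C ^ (N + 1)
    \<le> (\<Sum>k\<in>(\<Union>n\<in>{n\<^sub>0..n\<^sub>1}. corner_shell i n). (C * real_of_int (k i)) powr - (real N + \<epsilon>))"
proof -
  have "0 < N" by (simp add: N_def)
  have shell_term: "B powr - \<epsilon> / C ^ (N + 1) * (1 / real n)
      \<le> (\<Sum>k\<in>corner_shell i n. (C * real_of_int (k i)) powr - (real N + \<epsilon>))"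
    if n: "n \<in> {n\<^sub>0..n\<^sub>1}" for n
  proof -
    have "0 < real n" "real n \<le> B" using n assms by auto
    have "C powr (real N + \<epsilon>) \<le> C powr real (N + 1)" using assms by (intro powr_mono) auto
    also have "\<dots> = C ^ (N + 1)" using \<open>1 \<le> C\<close> by (subst powr_realpow) auto
    finally have "1 / C ^ (N + 1) \<le> C powr - (real N + \<epsilon>)"
      using \<open>1 \<le> C\<close> unfolding powr_minus_divide by (intro divide_left_mono) auto
    moreover have "B powr - \<epsilon> \<le> real n powr - \<epsilon>"
      using \<open>0 < real n\<close> \<open>real n \<le> B\<close> assms by (intro powr_mono2') auto
    ultimately have 1: "B powr - \<epsilon> * (1 / C ^ (N + 1)) \<le> real n powr - \<epsilon> * C powr - (real N + \<epsilon>)"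
      using \<open>1 \<le> C\<close> by (intro mult_mono) auto
    have "1 / real n = real n ^ (N - 1) * real n powr - real N"
    proof -
      have "real n powr - real N = 1 / real n ^ N"
        using \<open>0 < real n\<close> by (simp add: powr_minus_divide powr_realpow)
      then show ?thesis using \<open>0 < N\<close> \<open>0 < real n\<close> by (cases N) auto
    qed
    also have "\<dots> \<le> real ((n + 1) ^ (N - 1)) * real n powr - real N"
      by (intro mult_right_mono) (auto intro!: power_mono)
    finally have 2: "1 / real n \<le> real ((n + 1) ^ (N - 1)) * real n powr - real N" .
    have "B powr - \<epsilon> / C ^ (N + 1) * (1 / real n) \<le>
        (real n powr - \<epsilon> * C powr - (real N + \<epsilon>)) * (real ((n + 1) ^ (N - 1)) * real n powr - real N)"
      using 1 2 by (intro mult_mono) auto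
    also have "\<dots> = real ((n + 1) ^ (N - 1)) * (C * real n) powr - (real N + \<epsilon>)"
    proof -
      have "(C * real n) powr - (real N + \<epsilon>) =
          C powr - (real N + \<epsilon>) * (real n powr - real N * real n powr - \<epsilon>)"
        by (simp add: powr_mult powr_add[symmetric])
      then show ?thesis by (simp add: mult_ac)
    qed
    also have "\<dots> = (\<Sum>k\<in>(corner_shell i n :: ('n \<Rightarrow> int) set). (C * real n) powr - (real N + \<epsilon>))"
      by (simp add: card_corner_shell N_def)
    also have "\<dots> = (\<Sum>k\<in>corner_shell i n. (C * real_of_int (k i)) powr - (real N + \<epsilon>))"
      by (rule sum.cong) (auto simp: corner_shell_def)
    finally show ?thesis .
  qed
  have "B powr - \<epsilon> * ln (real (n\<^sub>1 + 1) / real n\<^sub>0) / C ^ (N + 1)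
      \<le> B powr - \<epsilon> / C ^ (N + 1) * (\<Sum>n=n\<^sub>0..n\<^sub>1. 1 / real n)"
    using mult_left_mono[OF harmonic_ge_ln[OF \<open>0 < n\<^sub>0\<close> \<open>n\<^sub>0 \<le> n\<^sub>1\<close>], of "B powr - \<epsilon> / C ^ (N + 1)"]
      \<open>1 \<le> C\<close> by simp
  also have "\<dots> = (\<Sum>n=n\<^sub>0..n\<^sub>1. B powr - \<epsilon> / C ^ (N + 1) * (1 / real n))"
    by (rule sum_distrib_left)
  also have "\<dots> \<le> (\<Sum>n=n\<^sub>0..n\<^sub>1. \<Sum>k\<in>corner_shell i n. (C * real_of_int (k i)) powr - (real N + \<epsilon>))"
    by (rule sum_mono) (rule shell_term)
  also have "\<dots> = (\<Sum>k\<in>(\<Union>n\<in>{n\<^sub>0..n\<^sub>1}. corner_shell i n). (C * real_of_int (k i)) powr - (real N + \<epsilon>))"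
    using finite_corner_shell
    by (intro sum.UNION_disjoint[symmetric]) (auto simp: corner_shell_def)
  finally show ?thesis .
qed

section \<open>The lower bound\<close>

context zorich
begin

text \<open>
  The pieces of the coded set. All indices are even, so there are no reflections and different pieces
  are at a positive distance. The bounds on the last coordinate make the pieces compact and keep
  orbits out of the lower half-space.
\<close>
definition slab :: "real \<Rightarrow> ('n \<Rightarrow> int) \<Rightarrow> 'n space set" where
  "slab a k = {x \<in> cell \<rho> (\<lambda>j. 2 * k j). 0 \<le> snd x \<and> snd x \<le> a}"

text \<open>
  Chosen such that \<open>slab_norm_le\<close> holds: each of the \<open>N\<close> coordinates is at most
  \<open>5 * \<rho> * n\<close>, and the last one is at most \<open>2 * n\<close> after adding \<open>a\<close>.
\<close>
definition growth :: real where
  "growth = 5 * real CARD('n) * \<rho> + 2"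

lemma norm_fst_cell_le:
  fixes x :: "'n space"
  assumes "x \<in> cell \<rho> q"
  shows "norm (fst x) \<le> (\<Sum>j\<in>UNIV. 2 * \<rho> * \<bar>of_int (q j)\<bar> + \<rho>)"
proof -
  have "\<bar>fst x $ j\<bar> \<le> 2 * \<rho> * \<bar>of_int (q j)\<bar> + \<rho>" for j
  proof -
    have "\<bar>fst x $ j - 2 * \<rho> * of_int (q j)\<bar> \<le> \<rho>" using assms by (simp add: cell_def)
    moreover have "\<bar>2 * \<rho> * of_int (q j)\<bar> = 2 * \<rho> * \<bar>of_int (q j)\<bar>"
      using \<rho>_pos by (simp add: abs_mult)
    ultimately show ?thesis by linarith
  qed
  then have "(\<Sum>j\<in>UNIV. \<bar>fst x $ j\<bar>) \<le> (\<Sum>j\<in>UNIV. 2 * \<rho> * \<bar>of_int (q j)\<bar> + \<rho>)"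
    by (intro sum_mono)
  then show ?thesis using norm_le_l1_cart[of "fst x"] by linarith
qed

lemma compact_slab: "compact (slab a k)"
proof -
  have "closed (slab a k)"
    unfolding slab_def by (intro closed_Collect_conj closed_Collect_le continuous_intros)
      (simp add: closed_cell)
  moreover have "bounded (slab a k)"
  proof (rule boundedI)
    fix x assume "x \<in> slab a k"
    then have "norm (fst x) \<le> (\<Sum>j\<in>UNIV. 2 * \<rho> * \<bar>of_int (2 * k j)\<bar> + \<rho>)" "norm (snd x) \<le> a"
      using norm_fst_cell_le[of x "\<lambda>j. 2 * k j"] by (simp_all add: slab_def)
    then show "norm x \<le> (\<Sum>j\<in>UNIV. 2 * \<rho> * \<bar>of_int (2 * k j)\<bar> + \<rho>) + a"
      using norm_Pair_le[of "fst x" "snd x"] by simp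
  qed
  ultimately show ?thesis by (simp add: compact_eq_bounded_closed)
qed

lemma slab_nonempty: "0 \<le> a \<Longrightarrow> slab a k \<noteq> {}"
proof -
  assume "0 \<le> a"
  then have "((\<chi> j. 2 * \<rho> * of_int (2 * k j)), 0) \<in> slab a k"
    using \<rho>_pos by (simp add: slab_def cell_def)
  then show ?thesis by blast
qed

lemma slab_separated:
  assumes "k \<noteq> k'" "x \<in> slab a k" "y \<in> slab a k'"
  shows "2 * \<rho> \<le> dist x y"
proof -
  obtain j where "k j \<noteq> k' j" using assms(1) by auto
  then have "1 \<le> \<bar>k j - k' j\<bar>" by linarith
  then have "1 \<le> \<bar>real_of_int (k j) - real_of_int (k' j)\<bar>" by linarith
  then have "4 * \<rho> * 1 \<le> 4 * \<rho> * \<bar>real_of_int (k j) - real_of_int (k' j)\<bar>"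
    using \<rho>_pos by (intro mult_left_mono) auto
  also have "\<dots> = \<bar>2 * \<rho> * of_int (2 * k j) - 2 * \<rho> * of_int (2 * k' j)\<bar>"
  proof -
    have "\<bar>4 * \<rho> * (real_of_int (k j) - real_of_int (k' j))\<bar> =
        4 * \<rho> * \<bar>real_of_int (k j) - real_of_int (k' j)\<bar>"
      using \<rho>_pos by (simp add: abs_mult)
    moreover have "4 * \<rho> * (real_of_int (k j) - real_of_int (k' j)) =
        2 * \<rho> * of_int (2 * k j) - 2 * \<rho> * of_int (2 * k' j)"
      by (simp add: algebra_simps)
    ultimately show ?thesis by simp
  qed
  finally have "4 * \<rho> \<le> \<bar>2 * \<rho> * of_int (2 * k j) - 2 * \<rho> * of_int (2 * k' j)\<bar>" by simp
  moreover have "\<bar>fst x $ j - 2 * \<rho> * of_int (2 * k j)\<bar> \<le> \<rho>" "\<bar>fst y $ j - 2 * \<rho> * of_int (2 * k' j)\<bar> \<le> \<rho>"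
    using assms(2,3) unfolding slab_def cell_def by blast+
  ultimately have "2 * \<rho> \<le> dist (fst x $ j) (fst y $ j)" unfolding dist_real_def by linarith
  also have "\<dots> \<le> dist x y"
    using dist_vec_nth_le[of "fst x" j "fst y"] dist_fst_le[of x y] by linarith
  finally show ?thesis .
qed

lemma slab_norm_le:
  assumes "k \<in> corner_shell i n" "1 \<le> a" "a \<le> real n" "x \<in> slab a k"
  shows "norm (fst x, snd x + a) \<le> growth * real n"
proof -
  have n: "1 \<le> real n" using assms by linarith
  have "norm (fst x) \<le> (\<Sum>j\<in>UNIV. 2 * \<rho> * \<bar>of_int (2 * k j)\<bar> + \<rho>)"
    using assms(4) norm_fst_cell_le[of x "\<lambda>j. 2 * k j"] by (simp add: slab_def)
  also have "\<dots> \<le> (\<Sum>j\<in>(UNIV :: 'n set). 5 * \<rho> * real n)"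
  proof (rule sum_mono)
    fix j
    have "0 \<le> k j" "k j \<le> int n" using assms(1) by (auto simp: corner_shell_def)
    then have "\<bar>real_of_int (2 * k j)\<bar> \<le> 2 * real n" by linarith
    then have "2 * \<rho> * \<bar>real_of_int (2 * k j)\<bar> \<le> 2 * \<rho> * (2 * real n)"
      using \<rho>_pos by (intro mult_left_mono) auto
    moreover have "\<rho> * 1 \<le> \<rho> * real n" using \<rho>_pos n by (intro mult_left_mono) auto
    ultimately show "2 * \<rho> * \<bar>of_int (2 * k j)\<bar> + \<rho> \<le> 5 * \<rho> * real n" by simp
  qed
  finally have "norm (fst x) \<le> 5 * real CARD('n) * \<rho> * real n" by simp
  moreover have "norm (snd x + a) \<le> 2 * real n" using assms by (simp add: slab_def)
  ultimately show ?thesis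
    using norm_Pair_le[of "fst x" "snd x + a"] by (simp add: growth_def algebra_simps)
qed

text \<open>
  The derivative at \<open>x\<close> is governed by \<open>exp (snd x)\<close>, which is the norm of
  \<open>F x\<close> and hence bounded by the letter of the image. The factor \<open>exp (2 * \<rho>)\<close> accounts
  for the last coordinate of the nearby point \<open>y\<close>, whose image may lie in a slab much farther out.
\<close>
lemma slab_expand:
  assumes "k' \<in> corner_shell i n" "1 \<le> a" "a \<le> real n"
    and "x \<in> slab a k" "y \<in> slab a k" "f a x \<in> slab a k'" "dist x y < 2 * \<rho>"
  shows "dist (f a x) (f a y) \<le> L * exp (2 * \<rho>) * growth * real n * dist x y"
proof -
  have "F x = (fst (f a x), snd (f a x) + a)" by (simp add: shifted_def prod_eq_iff)
  then have exp_x: "exp (snd x) \<le> growth * real n"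
    using slab_norm_le[OF assms(1-3,6)] norm_F[of x] by simp
  have "\<bar>snd x - snd y\<bar> \<le> dist x y" using dist_snd_le[of x y] by (simp add: dist_real_def)
  then have "max (snd x) (snd y) \<le> 2 * \<rho> + snd x" using assms(7) by linarith
  then have "exp (max (snd x) (snd y)) \<le> exp (2 * \<rho>) * exp (snd x)" by (simp flip: exp_add)
  also have "\<dots> \<le> exp (2 * \<rho>) * (growth * real n)" using exp_x by simp
  finally have "L * exp (max (snd x) (snd y)) * dist x y \<le> L * (exp (2 * \<rho>) * (growth * real n)) * dist x y"
    using L_ge_1 by (intro mult_right_mono mult_left_mono) auto
  moreover have "dist (f a x) (f a y) \<le> L * exp (max (snd x) (snd y)) * dist x y"
    unfolding dist_f using assms by (intro dist_F_cell) (auto simp: slab_def)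
  ultimately show ?thesis by (simp add: mult.assoc)
qed

lemma continuous_on_slab: "continuous_on (slab a k) (f a)"
proof (rule lipschitz_on_continuous_on)
  show "(L * exp a)-lipschitz_on (slab a k) (f a)"
  proof (rule lipschitz_onI)
    fix x y assume xy: "x \<in> slab a k" "y \<in> slab a k"
    then have "dist (f a x) (f a y) \<le> L * exp (max (snd x) (snd y)) * dist x y"
      unfolding dist_f by (intro dist_F_cell) (auto simp: slab_def)
    also have "\<dots> \<le> L * exp a * dist x y"
      using xy L_ge_1 by (intro mult_right_mono mult_left_mono) (auto simp: slab_def)
    finally show "dist (f a x) (f a y) \<le> L * exp a * dist x y" .
  qed (use L_ge_1 in auto)
qed

text \<open>
  The condition on \<open>exp a\<close> says that the logarithmic height of the preimage, \<open>ln (norm p)\<close>, does not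
  exceed the height \<open>a\<close> of the slabs.
\<close>
lemma slab_onto:
  assumes "k' \<in> corner_shell i n" "1 \<le> a" "a \<le> real n" "growth * real n \<le> exp a"
  shows "slab a k' \<subseteq> f a ` slab a k"
proof
  fix y assume y: "y \<in> slab a k'"
  define p where "p = (fst y, snd y + a)"
  have "a \<le> snd p" using y by (simp add: p_def slab_def)
  then have "a \<le> norm p" using norm_snd_le[of "snd p" "fst p"] by simp
  then have "p \<noteq> 0" "1 \<le> norm p" using assms(2) by auto
  have "norm p \<le> exp a" using slab_norm_le[OF assms(1-3) y] assms(4) by (simp add: p_def)
  obtain x where x: "x \<in> cell \<rho> (\<lambda>j. 2 * k j)" "F x = p" "snd x = ln (norm p)"
    using preimage_in_even_cell[OF \<open>p \<noteq> 0\<close>] \<open>a \<le> snd p\<close> assms(2) by fastforce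
  have "f a x = y" using x(2) by (simp add: shifted_def p_def prod_eq_iff)
  moreover have "ln (norm p) \<le> ln (exp a)"
    using \<open>norm p \<le> exp a\<close> \<open>1 \<le> norm p\<close> by (subst ln_le_cancel_iff) auto
  then have "x \<in> slab a k" using x \<open>1 \<le> norm p\<close> by (simp add: slab_def)
  ultimately show "y \<in> f a ` slab a k" by blast
qed

text \<open>
  The orbits in the slabs have nonnegative last coordinates, hence cannot converge to a
  point of the lower half-space.
\<close>
lemma dim_J_bd_ge:
  fixes i :: 'n and n\<^sub>0 n\<^sub>1 :: nat
  defines "E \<equiv> (\<Union>n\<in>{n\<^sub>0..n\<^sub>1}. corner_shell i n)"
  assumes "1 \<le> a" "a \<le> real n\<^sub>0" "growth * real n\<^sub>1 \<le> exp a" "0 < s" "snd \<xi> < 0"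
    and sum: "1 \<le> (\<Sum>k\<in>E. (L * exp (2 * \<rho>) * growth * real_of_int (k i)) powr - s)"
  shows "ereal s \<le> hausdorff_dim (J_bd (f a) \<xi>)"
proof -
  let ?C = "L * exp (2 * \<rho>) * growth"
  have growth: "2 \<le> growth" using \<rho>_pos by (simp add: growth_def)
  have C: "2 \<le> ?C"
  proof -
    have "1 * 1 * 2 \<le> ?C" using L_ge_1 \<rho>_pos growth by (intro mult_mono) auto
    then show ?thesis by simp
  qed
  have E: "k \<in> corner_shell i (nat (k i))" "a \<le> real (nat (k i))" "growth * real (nat (k i)) \<le> exp a"
      "real (nat (k i)) = real_of_int (k i)" if "k \<in> E" for k
  proof -
    obtain n where n: "n\<^sub>0 \<le> n" "n \<le> n\<^sub>1" "k \<in> corner_shell i n" using \<open>k \<in> E\<close> by (auto simp: E_def)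
    then have "k i = int n" by (simp add: corner_shell_def)
    then show "k \<in> corner_shell i (nat (k i))" "a \<le> real (nat (k i))"
        "real (nat (k i)) = real_of_int (k i)"
      using n assms(3) by auto
    have "growth * real n \<le> growth * real n\<^sub>1" using n growth by (intro mult_left_mono) auto
    then show "growth * real (nat (k i)) \<le> exp a" using \<open>k i = int n\<close> assms(4) by simp
  qed
  have finite: "finite E" unfolding E_def using finite_corner_shell by blast
  show ?thesis
  proof (rule hausdorff_dim_ge_coded[where E = E and \<delta> = "2 * \<rho>" and P = "slab a" and f = "f a"
        and lam = "\<lambda>k. ?C * real_of_int (k i)"])
    show "2 \<le> ?C * real_of_int (k i)" if "k \<in> E" for k
    proof -
      have "1 \<le> real_of_int (k i)" using E[OF that] \<open>1 \<le> a\<close> by linarith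
      then have "2 * 1 \<le> ?C * real_of_int (k i)" using C by (intro mult_mono) auto
      then show ?thesis by simp
    qed
    show "dist (f a x) (f a y) \<le> ?C * real_of_int (k' i) * dist x y"
      if "k \<in> E" "k' \<in> E" "x \<in> slab a k" "y \<in> slab a k" "f a x \<in> slab a k'" "dist x y < 2 * \<rho>"
      for k k' x y
      using slab_expand[OF E(1)[OF that(2)] \<open>1 \<le> a\<close> E(2)[OF that(2)] that(3-6)] E(4)[OF that(2)]
      by simp
    show "\<exists>x\<in>J_bd (f a) \<xi>. \<forall>n. (f a ^^ n) x \<in> slab a (\<omega> n)"
      if \<omega>: "\<And>n. \<omega> n \<in> E" for \<omega> :: "nat \<Rightarrow> 'n \<Rightarrow> int"
    proof -
      have "\<exists>x. \<forall>n. (f a ^^ n) x \<in> slab a (\<omega> n)"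
      proof (rule itinerary_exists[where E = E])
        show "slab a k' \<subseteq> f a ` slab a k" if "k \<in> E" "k' \<in> E" for k k'
          using E[OF that(2)] \<open>1 \<le> a\<close> by (intro slab_onto)
      qed (use compact_slab slab_nonempty continuous_on_slab \<open>1 \<le> a\<close> \<omega> in auto)
      then obtain x where x: "\<And>n. (f a ^^ n) x \<in> slab a (\<omega> n)" by blast
      have "\<not> (\<lambda>n. (f a ^^ n) x) \<longlonglongrightarrow> \<xi>"
      proof
        assume "(\<lambda>n. (f a ^^ n) x) \<longlonglongrightarrow> \<xi>"
        then have "(\<lambda>n. snd ((f a ^^ n) x)) \<longlonglongrightarrow> snd \<xi>" by (rule tendsto_snd)
        moreover have "0 \<le> snd ((f a ^^ n) x)" for n using x[of n] by (simp add: slab_def)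
        ultimately have "0 \<le> snd \<xi>" by (intro LIMSEQ_le_const) auto
        then show False using assms(6) by simp
      qed
      moreover have "bounded (range (\<lambda>n. (f a ^^ n) x))"
      proof (rule bounded_subset)
        show "bounded (\<Union>k\<in>E. slab a k)"
          using finite compact_slab by (intro bounded_UN) (auto intro: compact_imp_bounded)
        show "range (\<lambda>n. (f a ^^ n) x) \<subseteq> (\<Union>k\<in>E. slab a k)" using x \<omega> by blast
      qed
      ultimately have "x \<in> J_bd (f a) \<xi>" by (simp add: J_bd_def)
      then show ?thesis using x by blast
    qed
  qed (use finite slab_separated \<rho>_pos assms in auto)
qed

section \<open>Both bounds for large parameters\<close>

lemma eventually_basin:
  "\<forall>\<^sub>F a in at_top. snd (attracting_fixpoint (f a) m) < 0 \<and>
     (\<forall>x. snd x \<le> m \<longrightarrow> (\<lambda>n. (f a ^^ n) x) \<longlonglongrightarrow> attracting_fixpoint (f a) m)"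
proof -
  have lim: "((\<lambda>a. exp (c - a)) \<longlongrightarrow> 0) at_top" for c :: real by real_asymp
  have "0 < 1 / (2 * L)" using L_ge_1 by simp
  have "\<forall>\<^sub>F a in at_top. exp (\<rho> - a) < 1 / (2 * L)" "\<forall>\<^sub>F a in at_top. exp (\<rho> - a) < \<rho>"
      "\<forall>\<^sub>F a in at_top. exp (exp m - a) < \<rho>"
    using order_tendstoD(2)[OF lim \<open>0 < 1 / (2 * L)\<close>] order_tendstoD(2)[OF lim \<rho>_pos] by auto
  moreover have "\<forall>\<^sub>F a in at_top. \<rho> - m \<le> a" "\<forall>\<^sub>F a in at_top. \<rho> < a"
    by (rule eventually_ge_at_top, rule eventually_gt_at_top)
  ultimately show ?thesis
  proof eventually_elim
    case (elim a)
    have "L * exp (\<rho> - a) \<le> L * (1 / (2 * L))" using elim L_ge_1 by (intro mult_left_mono) auto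
    then have "L * exp (\<rho> - a) \<le> 1 / 2" using L_ge_1 by simp
    then show ?case using halfspace_in_basin[of a m] elim by auto
  qed
qed

text \<open>
  With \<open>\<epsilon> = ln (ln a) / ln a\<close> the lattice sum is of order \<open>1 / ln (ln a)\<close>.
\<close>
lemma eventually_dim_J_r_le:
  "\<forall>\<^sub>F a in at_top. hausdorff_dim (J_r (f a) (attracting_fixpoint (f a) m))
     \<le> ereal (real CARD('n) + ln (ln a) / ln a)"
proof -
  let ?N = "CARD('n)"
  define B where "B = L / min 1 \<rho>"
  have "1 \<le> B"
  proof -
    have "1 * min 1 \<rho> \<le> L" using L_ge_1 by simp
    then show ?thesis using \<rho>_pos by (simp add: B_def pos_le_divide_eq)
  qed
  define K where "K = B ^ (?N + 1) * (3 ^ ?N * 2 ^ (?N + 1) * 4)"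
  have "0 < K" using \<open>1 \<le> B\<close> by (simp add: K_def)
  have "filterlim (\<lambda>a::real. ln (ln a)) at_top at_top" by real_asymp
  then have "\<forall>\<^sub>F a in at_top. 2 * K \<le> ln (ln a)" by (simp add: filterlim_at_top)
  moreover have "\<forall>\<^sub>F a::real in at_top. 0 < ln (ln a) / ln a" "\<forall>\<^sub>F a::real in at_top. ln (ln a) / ln a \<le> 1"
      "\<forall>\<^sub>F a::real in at_top. 0 < ln a"
    by real_asymp+
  moreover have "\<forall>\<^sub>F a in at_top. max 1 (1 - m) \<le> a" by (rule eventually_ge_at_top)
  ultimately show ?thesis using eventually_basin[of m]
  proof eventually_elim
    case (elim a)
    define \<epsilon> where "\<epsilon> = ln (ln a) / ln a"
    define s where "s = real ?N + \<epsilon>"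
    have "1 \<le> a" "1 \<le> a + m" using elim by auto
    have "0 < s" using elim by (simp add: s_def \<epsilon>_def add_pos_pos)
    have "B powr s \<le> B powr real (?N + 1)"
      using \<open>1 \<le> B\<close> elim by (intro powr_mono) (auto simp: s_def \<epsilon>_def)
    then have Bs: "B powr s \<le> B ^ (?N + 1)" using \<open>1 \<le> B\<close> powr_realpow[of B "?N + 1"] by simp
    have "a powr - \<epsilon> = 1 / ln a"
      using elim \<open>1 \<le> a\<close> by (simp add: powr_def \<epsilon>_def exp_minus inverse_eq_divide)
    then have a_eps: "a powr - \<epsilon> / \<epsilon> = 1 / ln (ln a)" using elim by (simp add: \<epsilon>_def)
    have rate: "rate a q powr s = B powr s * max a (sup_norm q) powr - s" for q
    proof -
      have "rate a q = B * (1 / max a (sup_norm q))" by (simp add: rate_def B_def)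
      then show ?thesis using \<open>1 \<le> a\<close> by (simp add: powr_mult powr_divide powr_minus_divide)
    qed
    have "(\<integral>\<^sup>+ q. ennreal (rate a q powr s) \<partial>count_space UNIV) =
        ennreal (B powr s) * (\<integral>\<^sup>+ q. ennreal (max a (sup_norm (q :: 'n \<Rightarrow> int)) powr - s) \<partial>count_space UNIV)"
      unfolding rate by (simp add: ennreal_mult nn_integral_cmult)
    also have "\<dots> \<le> ennreal (B ^ (?N + 1)) * ennreal (3 ^ ?N * 2 ^ (?N + 1) * 4 * (a powr - \<epsilon> / \<epsilon>))"
      unfolding s_def using Bs \<open>1 \<le> a\<close> elim
      by (intro mult_mono nn_integral_lattice_le ennreal_leI) (auto simp: \<epsilon>_def s_def)
    also have "\<dots> = ennreal (K * (1 / ln (ln a)))"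
      using \<open>1 \<le> B\<close> unfolding a_eps by (simp add: K_def mult.assoc flip: ennreal_mult')
    also have "\<dots> \<le> ennreal (1 / 2)"
    proof (rule ennreal_leI)
      have "0 < ln (ln a)" using elim(1) \<open>0 < K\<close> by linarith
      moreover have "K \<le> 1 / 2 * ln (ln a)" using elim(1) by linarith
      ultimately have "K / ln (ln a) \<le> 1 / 2" by (subst pos_divide_le_eq)
      then show "K * (1 / ln (ln a)) \<le> 1 / 2" by simp
    qed
    finally have sum: "(\<integral>\<^sup>+ q. ennreal (rate a q powr s) \<partial>count_space UNIV) \<le> ennreal (1 / 2)" .
    show ?case
      unfolding \<epsilon>_def[symmetric] s_def[symmetric]
    proof (rule dim_J_r_le[OF _ _ _ sum, of m])
      show "(\<lambda>n. (f a ^^ n) x) \<longlonglongrightarrow> attracting_fixpoint (f a) m" if "snd x \<le> m" for x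
        using elim that by blast
    qed (use \<open>1 \<le> a\<close> \<open>1 \<le> a + m\<close> \<open>0 < s\<close> in auto)
  qed
qed

text \<open>
  The exponent \<open>3 / 2\<close> of the outer radius is a compromise: the shells between \<open>a\<close> and
  \<open>a powr (3 / 2)\<close> give the factor \<open>1 / 2 * ln a\<close>, while for
  \<open>\<epsilon> = 1 / 2 * (ln (ln a) / ln a)\<close> the outer radius to the power \<open>- \<epsilon>\<close> is
  still as large as \<open>ln a powr (- 3 / 4)\<close>.
\<close>
lemma eventually_dim_J_bd_ge:
  "\<forall>\<^sub>F a in at_top. ereal (real CARD('n) + 1 / 2 * (ln (ln a) / ln a))
     \<le> hausdorff_dim (J_bd (f a) (attracting_fixpoint (f a) m))"
proof -
  let ?N = "CARD('n)"
  define C where "C = L * exp (2 * \<rho>) * growth"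
  have growth: "2 \<le> growth" using \<rho>_pos by (simp add: growth_def)
  have "1 \<le> C"
  proof -
    have "1 * 1 * 1 \<le> C" unfolding C_def using L_ge_1 \<rho>_pos growth by (intro mult_mono) auto
    then show ?thesis by simp
  qed
  have "filterlim (\<lambda>a::real. ln a powr (-3/4) * (1 / 2 * ln a - ln 2)) at_top at_top" by real_asymp
  then have "\<forall>\<^sub>F a in at_top. C ^ (?N + 1) \<le> ln a powr (-3/4) * (1 / 2 * ln a - ln 2)"
    by (simp add: filterlim_at_top)
  moreover have "filterlim (\<lambda>a::real. exp a / a powr (3/2)) at_top at_top" by real_asymp
  then have "\<forall>\<^sub>F a in at_top. growth \<le> exp a / a powr (3/2)" by (simp add: filterlim_at_top)
  moreover have "\<forall>\<^sub>F a::real in at_top. 0 < 1 / 2 * (ln (ln a) / ln a)"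
      "\<forall>\<^sub>F a::real in at_top. 1 / 2 * (ln (ln a) / ln a) \<le> 1"
      "\<forall>\<^sub>F a::real in at_top. 0 < ln a" "\<forall>\<^sub>F a::real in at_top. a + 2 \<le> a powr (3/2)"
    by real_asymp+
  moreover have "\<forall>\<^sub>F a::real in at_top. 1 \<le> a" by (rule eventually_ge_at_top)
  ultimately show ?thesis using eventually_basin[of m]
  proof eventually_elim
    case (elim a)
    define \<epsilon> where "\<epsilon> = 1 / 2 * (ln (ln a) / ln a)"
    define s where "s = real ?N + \<epsilon>"
    define n\<^sub>0 where "n\<^sub>0 = nat \<lceil>a\<rceil>"
    define n\<^sub>1 where "n\<^sub>1 = nat \<lfloor>a powr (3/2)\<rfloor>"
    obtain i :: 'n where True by blast
    have n0: "a \<le> real n\<^sub>0" "real n\<^sub>0 \<le> a + 1" using \<open>1 \<le> a\<close> by (simp_all add: n\<^sub>0_def)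
    have n1: "real n\<^sub>1 \<le> a powr (3/2)" "a powr (3/2) \<le> real (n\<^sub>1 + 1)"
      by (simp_all add: n\<^sub>1_def) linarith+
    have "real n\<^sub>0 \<le> real n\<^sub>1" using n0 n1 elim(6) by simp
    then have "n\<^sub>0 \<le> n\<^sub>1" by simp
    have "0 < n\<^sub>0" using n0 \<open>1 \<le> a\<close> by simp
    have log: "1 / 2 * ln a - ln 2 \<le> ln (real (n\<^sub>1 + 1) / real n\<^sub>0)"
    proof -
      have "real n\<^sub>0 \<le> 2 * a" using n0 \<open>1 \<le> a\<close> by linarith
      then have "a powr (3/2) / (2 * a) \<le> real (n\<^sub>1 + 1) / real n\<^sub>0"
        using n1 \<open>0 < n\<^sub>0\<close> \<open>1 \<le> a\<close> by (intro frac_le) auto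
      then have "ln (a powr (3/2) / (2 * a)) \<le> ln (real (n\<^sub>1 + 1) / real n\<^sub>0)"
        using \<open>0 < n\<^sub>0\<close> \<open>1 \<le> a\<close> by (subst ln_le_cancel_iff) auto
      moreover have "ln (a powr (3/2) / (2 * a)) = 1 / 2 * ln a - ln 2"
        using \<open>1 \<le> a\<close> by (simp add: ln_div ln_mult ln_powr)
      ultimately show ?thesis by simp
    qed
    have pow: "(a powr (3/2)) powr - \<epsilon> = ln a powr (-3/4)"
      using elim by (simp add: powr_powr) (simp add: powr_def \<epsilon>_def)
    have "C ^ (?N + 1) \<le> (a powr (3/2)) powr - \<epsilon> * ln (real (n\<^sub>1 + 1) / real n\<^sub>0)"
      unfolding pow by (rule order_trans[OF elim(1)]) (intro mult_left_mono log, simp)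
    then have "1 \<le> (a powr (3/2)) powr - \<epsilon> * ln (real (n\<^sub>1 + 1) / real n\<^sub>0) / C ^ (?N + 1)"
      using \<open>1 \<le> C\<close> by (subst pos_le_divide_eq) auto
    also have "\<dots> \<le> (\<Sum>k\<in>(\<Union>n\<in>{n\<^sub>0..n\<^sub>1}. corner_shell i n). (C * real_of_int (k i)) powr - s)"
      unfolding s_def
      by (rule corner_shell_sum_ge[OF \<open>1 \<le> C\<close> _ _ \<open>0 < n\<^sub>0\<close> \<open>n\<^sub>0 \<le> n\<^sub>1\<close> n1(1)])
        (use elim in \<open>auto simp: \<epsilon>_def\<close>)
    finally have sum: "1 \<le> (\<Sum>k\<in>(\<Union>n\<in>{n\<^sub>0..n\<^sub>1}. corner_shell i n). (C * real_of_int (k i)) powr - s)" .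
    have "growth * real n\<^sub>1 \<le> growth * a powr (3/2)" using growth n1 by (intro mult_left_mono) auto
    also have "\<dots> \<le> exp a" using elim(2) \<open>1 \<le> a\<close> by (simp add: pos_le_divide_eq)
    finally have top: "growth * real n\<^sub>1 \<le> exp a" .
    have "ereal s \<le> hausdorff_dim (J_bd (f a) (attracting_fixpoint (f a) m))"
    proof (rule dim_J_bd_ge[OF \<open>1 \<le> a\<close> n0(1) top])
      show "0 < s" using elim(3) by (simp add: s_def \<epsilon>_def add_pos_pos)
      show "snd (attracting_fixpoint (f a) m) < 0" using elim by blast
    qed (use sum in \<open>simp add: C_def\<close>)
    then show ?case by (simp add: s_def \<epsilon>_def)
  qed
qed

end

lemma J_bd_subset_J_r: "J_bd g \<xi> \<subseteq> J_r g \<xi>"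
proof
  fix x assume x: "x \<in> J_bd g \<xi>"
  then obtain R where R: "\<And>n. norm ((g ^^ n) x) \<le> R" by (auto simp: J_bd_def bounded_iff)
  have "\<not> filterlim (\<lambda>n. norm ((g ^^ n) x)) at_top sequentially"
  proof
    assume "filterlim (\<lambda>n. norm ((g ^^ n) x)) at_top sequentially"
    then have "\<forall>\<^sub>F n in sequentially. R < norm ((g ^^ n) x)" by (simp add: filterlim_at_top_dense)
    then show False using R by (auto simp: eventually_sequentially not_less[symmetric])
  qed
  then show "x \<in> J_r g \<xi>" using x by (simp add: J_bd_def J_r_def)
qed

theorem theorem1p1:
  fixes \<rho> \<alpha> m M :: real
    and h :: "real ^ 'n::finite \<Rightarrow> 'n space"
    and F :: "'n space \<Rightarrow> 'n space"
    and d :: nat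
  assumes "d = DIM('n space)"
    and "zorich_map \<rho> h F"
    and "zorich_constants F \<alpha> m M"
  shows "\<exists>a\<^sub>0. \<forall>a\<ge>a\<^sub>0.
     (let f = shifted F a; \<xi> = attracting_fixpoint f m in
        ereal (real d - 1 + 1 / 2 * (ln (ln a) / ln a) - ln (ln (ln a)) / ln a)
          < hausdorff_dim (J_bd f \<xi>) \<and>
        hausdorff_dim (J_bd f \<xi>) \<le> hausdorff_dim (J_r f \<xi>) \<and>
        hausdorff_dim (J_r f \<xi>) \<le> ereal (real d - 1 + ln (ln a) / ln a))"
proof -
  obtain L where "zorich \<rho> h F L" using zorich_locale[OF assms(2)] .
  then interpret zorich \<rho> h F L .
  have d: "real d - 1 = real CARD('n)" using assms(1) by simp
  have "\<forall>\<^sub>F a::real in at_top. 0 < ln (ln (ln a)) / ln a" by real_asymp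
  with eventually_dim_J_r_le[of m] eventually_dim_J_bd_ge[of m]
  have "\<forall>\<^sub>F a in at_top.
     (let f = shifted F a; \<xi> = attracting_fixpoint f m in
        ereal (real d - 1 + 1 / 2 * (ln (ln a) / ln a) - ln (ln (ln a)) / ln a)
          < hausdorff_dim (J_bd f \<xi>) \<and>
        hausdorff_dim (J_bd f \<xi>) \<le> hausdorff_dim (J_r f \<xi>) \<and>
        hausdorff_dim (J_r f \<xi>) \<le> ereal (real d - 1 + ln (ln a) / ln a))"
  proof eventually_elim
    case (elim a)
    have "ereal (real d - 1 + 1 / 2 * (ln (ln a) / ln a) - ln (ln (ln a)) / ln a)
        < ereal (real CARD('n) + 1 / 2 * (ln (ln a) / ln a))"
      unfolding d using elim(3) by simp
    then show ?case
      using elim(1,2) hausdorff_dim_mono[OF J_bd_subset_J_r] unfolding d Let_def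
      by (meson less_le_trans)
  qed
  then show ?thesis by (simp only: eventually_at_top_linorder)
qed

end
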